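(* Let $\gamma$ be any $C^\infty$ mapping from a neighborhood of $(x_0,0)\in\mathbb R^n\times\mathbb R^k$ to $\mathbb R^n$ satisfying $\gamma(x,0)\equiv x$. Then there exists a unique collection $\{X_\alpha:0\neq\alpha\in\mathbb N^k\}$ of $C^\infty$ vector fields, all defined in some common neighborhood $U$ of $x_0$, such that $$\gamma(x,t)=\exp\Big(\sum_{0<|\alpha|<N}t^\alpha X_\alpha/\alpha!\Big)(x)+O(|t|^N)$$ for each positive integer $N$, for all $x\in U$, as $|t|\to0$.
   Context: $\mathbb N=\{0,1,2,\dots\}$. For a $C^\infty$ vector field $X$ on an open subset of $\mathbb R^n$, $\exp(X)(x)$ denotes the value at time $1$ of the integral curve of $X$ starting at $x$; for each $N$ the expression $\exp(\sum_{0<|\alpha|<N}t^\alpha X_\alpha/\alpha!)(x)$ is defined for all sufficiently small $t$ (depending on $N$). *)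

theory Defs
  imports "HOL-Analysis.Analysis"
begin

(* Only meant for open S: the derivatives are full Frechet derivatives at the points of S,
   and the map x \<mapsto> Df(x) is tested on each fixed direction v. *)
primrec C_k_on :: "nat \<Rightarrow> 'a::euclidean_space set \<Rightarrow> ('a \<Rightarrow> 'b::euclidean_space) \<Rightarrow> bool" where
  "C_k_on 0 S f \<longleftrightarrow> continuous_on S f"
| "C_k_on (Suc k) S f \<longleftrightarrow>
     (\<forall>x\<in>S. f differentiable (at x)) \<and> (\<forall>v. C_k_on k S (\<lambda>x. frechet_derivative f (at x) v))"

definition smooth_on :: "'a::euclidean_space set \<Rightarrow> ('a \<Rightarrow> 'b::euclidean_space) \<Rightarrow> bool" where
  "smooth_on S f \<longleftrightarrow> (\<forall>k. C_k_on k S f)"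

(* A vector field on the open set U is a total function of which only the values on U matter;
   accordingly its integral curves are required to stay in U. *)
definition has_exp_vf ::
  "'a::euclidean_space set \<Rightarrow> ('a \<Rightarrow> 'a) \<Rightarrow> 'a \<Rightarrow> 'a \<Rightarrow> bool" where
  "has_exp_vf U X x y \<longleftrightarrow>
     (\<exists>c::real \<Rightarrow> 'a. c 0 = x \<and> c 1 = y \<and>
        (\<forall>s\<in>{0..1}. c s \<in> U \<and> (c has_vector_derivative X (c s)) (at s within {0..1})))"

definition exp_vf_defined :: "'a::euclidean_space set \<Rightarrow> ('a \<Rightarrow> 'a) \<Rightarrow> 'a \<Rightarrow> bool" where
  "exp_vf_defined U X x \<longleftrightarrow> (\<exists>y. has_exp_vf U X x y)"

(* For X smooth on an open U there is at most one such value. *)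
definition exp_vf :: "'a::euclidean_space set \<Rightarrow> ('a \<Rightarrow> 'a) \<Rightarrow> 'a \<Rightarrow> 'a" where
  "exp_vf U X x = (THE y. has_exp_vf U X x y)"

definition mi_order :: "nat ^ 'k::finite \<Rightarrow> nat" where
  "mi_order \<alpha> = (\<Sum>i\<in>UNIV. \<alpha> $ i)"

definition mi_fact :: "nat ^ 'k::finite \<Rightarrow> real" where
  "mi_fact \<alpha> = (\<Prod>i\<in>UNIV. fact (\<alpha> $ i))"

definition mi_power :: "real ^ 'k::finite \<Rightarrow> nat ^ 'k \<Rightarrow> real" where
  "mi_power t \<alpha> = (\<Prod>i\<in>UNIV. (t $ i) ^ (\<alpha> $ i))"

definition truncated_field ::
  "(nat ^ 'k::finite \<Rightarrow> 'a::euclidean_space \<Rightarrow> 'a) \<Rightarrow> nat \<Rightarrow> real ^ 'k \<Rightarrow> 'a \<Rightarrow> 'a" where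
  "truncated_field X N t x =
     (\<Sum>\<alpha> | 0 < mi_order \<alpha> \<and> mi_order \<alpha> < N. (mi_power t \<alpha> / mi_fact \<alpha>) *\<^sub>R X \<alpha> x)"

(* \<gamma>(x,t) = exp(truncated_field X N t)(x) + O(|t|^N) as |t| \<rightarrow> 0, uniformly for x in K;
   K = {x} gives the expansion at the single point x. That the exponential exists for all
   sufficiently small t is part of the assertion. *)
definition exp_expansion ::
  "('a::euclidean_space \<times> (real ^ 'k::finite) \<Rightarrow> 'a) \<Rightarrow> 'a set \<Rightarrow> (nat ^ 'k \<Rightarrow> 'a \<Rightarrow> 'a)
     \<Rightarrow> nat \<Rightarrow> 'a set \<Rightarrow> bool" where
  "exp_expansion \<gamma> U X N K \<longleftrightarrow>
     (\<exists>C \<delta>. 0 < \<delta> \<and> (\<forall>x\<in>K. \<forall>t. norm t < \<delta> \<longrightarrow>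
        exp_vf_defined U (truncated_field X N t) x \<and>
        norm (\<gamma> (x, t) - exp_vf U (truncated_field X N t) x) \<le> C * norm t ^ N))"

end

theory Submission
  imports Defs
begin

text \<open>Writing \<open>Z \<alpha> = X \<alpha> / \<alpha>!\<close>, repeated differentiation along an integral curve shows that the
  exponential of \<open>\<Sum>\<alpha>. t^\<alpha> Z \<alpha>\<close> has an asymptotic expansion whose coefficient of \<open>t^\<alpha>\<close> is \<open>Z \<alpha>\<close>
  plus an expression in the derivatives of the fields of lower order. Equating this with the Taylor
  coefficient of \<open>\<gamma>\<close> is a triangular system, which determines the fields recursively and uniquely.
  Taylor's formula for \<open>\<gamma>\<close> is itself an instance of the same expansion, for the constant field \<open>(0, t)\<close>.
  The exponentials exist because for small \<open>t\<close> the truncated field is small and a contraction on a ball.\<close>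

subsection \<open>Smooth maps\<close>

text \<open>The obstacle is that the coefficient equations involve derivatives of the unknown
  fields, while all fields must live on one common neighborhood. The field of index \<alpha> enters
  the equation of index \<alpha> only undifferentiated and with coefficient one, so that equation is
  solved by a subtraction and no domain shrinks as the order grows. Hence \<open>U\<close> can be
  the whole slice of points \<open>x\<close> with \<open>(x, 0)\<close> in \<open>W\<close>. The
  condition that \<gamma> is the identity at t = 0 is the equation of order zero, which no choice of
  fields could repair. Errors are estimated along each single integral curve, with constants that
  depend only on a compact set containing the curve; this gives the uniformity over compact sets.
  For uniqueness, bounds at single points are enough: the coefficients of an expansion in
  \<open>t\<close> are determined at each fixed point, and their equality on an open set can then be
  differentiated.\<close>

lemma frechet_derivative_cong_open:
  assumes "open S" "x \<in> S" "\<And>y. y \<in> S \<Longrightarrow> f y = g y"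
  shows "frechet_derivative f (at x) = frechet_derivative g (at x)"
proof -
  have "(f has_derivative f') (at x) \<longleftrightarrow> (g has_derivative f') (at x)" for f'
    using assms has_derivative_transform_within_open[of f f' x UNIV S g]
      has_derivative_transform_within_open[of g f' x UNIV S f] by auto
  then show ?thesis by (simp add: frechet_derivative_def)
qed

lemma C_k_on_cong:
  assumes "open S" "\<And>x. x \<in> S \<Longrightarrow> f x = g x" "C_k_on k S f"
  shows "C_k_on k S g"
  using assms(2,3)
proof (induction k arbitrary: f g)
  case 0
  then show ?case by (simp cong: continuous_on_cong)
next
  case (Suc k)
  have "g differentiable (at x)" if "x \<in> S" for x
  proof -
    have "f differentiable (at x)" using Suc.prems(2) that by simp
    then obtain f' where "(f has_derivative f') (at x)" by (auto simp: differentiable_def)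
    then have "(g has_derivative f') (at x)"
      using has_derivative_transform_within_open[OF _ assms(1) that] Suc.prems(1) by blast
    then show ?thesis by (auto simp: differentiable_def)
  qed
  moreover have "C_k_on k S (\<lambda>x. frechet_derivative g (at x) v)" for v
    using Suc.IH[of "\<lambda>x. frechet_derivative f (at x) v" "\<lambda>x. frechet_derivative g (at x) v"]
      Suc.prems frechet_derivative_cong_open[OF \<open>open S\<close>] by (metis C_k_on.simps(2))
  ultimately show ?case by simp
qed

lemma C_k_on_Suc_D: "C_k_on (Suc k) S f \<Longrightarrow> C_k_on k S f"
proof (induction k arbitrary: f)
  case 0
  then show ?case
    by (simp add: continuous_at_imp_continuous_on differentiable_imp_continuous_within)
next
  case (Suc k)
  then show ?case by (metis C_k_on.simps(2))
qed

text \<open>Trades \<open>frechet_derivative\<close> for an explicit derivative formula, so that the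
  closure properties follow from the usual differentiation rules; uniqueness of the derivative makes
  the two agree on \<open>S\<close>.\<close>

lemma C_k_on_SucI:
  assumes "open S" "\<And>x. x \<in> S \<Longrightarrow> (f has_derivative f' x) (at x)"
    and "\<And>v. C_k_on k S (\<lambda>x. f' x v)"
  shows "C_k_on (Suc k) S f"
proof -
  have "f' x = frechet_derivative f (at x)" if "x \<in> S" for x
    using assms(2) that frechet_derivative_at by blast
  then have "C_k_on k S (\<lambda>x. frechet_derivative f (at x) v)" for v
    using C_k_on_cong[OF assms(1) _ assms(3)[of v]] by simp
  then show ?thesis using assms(2) by (auto simp: differentiable_def)
qed

lemma C_k_on_SucD:
  assumes "C_k_on (Suc k) S f"
  shows "x \<in> S \<Longrightarrow> (f has_derivative frechet_derivative f (at x)) (at x)"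
    and "C_k_on k S (\<lambda>x. frechet_derivative f (at x) v)"
  using assms frechet_derivative_works by auto

lemma C_k_on_const: "open S \<Longrightarrow> C_k_on k S (\<lambda>x. c)"
proof (induction k arbitrary: c)
  case (Suc k)
  then show ?case by (intro C_k_on_SucI[where f' = "\<lambda>x v. 0"]) auto
qed simp

lemma C_k_on_id: "open S \<Longrightarrow> C_k_on k S (\<lambda>x. x)"
proof (cases k)
  case (Suc m)
  assume "open S"
  then show ?thesis
    unfolding Suc by (intro C_k_on_SucI[where f' = "\<lambda>x v. v"] C_k_on_const) auto
qed (simp)

lemma C_k_on_add:
  assumes "open S"
  shows "C_k_on k S f \<Longrightarrow> C_k_on k S g \<Longrightarrow> C_k_on k S (\<lambda>x. f x + g x)"
proof (induction k arbitrary: f g)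
  case (Suc k)
  show ?case
    by (rule C_k_on_SucI[OF assms has_derivative_add])
      (use Suc C_k_on_SucD in blast)+
qed (simp add: continuous_on_add)

lemma C_k_on_bounded_linear:
  assumes "open S" "bounded_linear h"
  shows "C_k_on k S f \<Longrightarrow> C_k_on k S (\<lambda>x. h (f x))"
proof (induction k arbitrary: f)
  case (Suc k)
  show ?case
    by (rule C_k_on_SucI[OF assms(1) bounded_linear.has_derivative[OF assms(2)]])
      (use Suc C_k_on_SucD in blast)+
qed (simp add: assms linear_continuous_on_compose bounded_linear.continuous_on)

lemma C_k_on_scaleR:
  fixes f :: "_ \<Rightarrow> real"
  assumes "open S"
  shows "C_k_on k S f \<Longrightarrow> C_k_on k S g \<Longrightarrow> C_k_on k S (\<lambda>x. f x *\<^sub>R g x)"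
proof (induction k arbitrary: f g)
  case (Suc k)
  show ?case
  proof (rule C_k_on_SucI[OF assms
        has_derivative_scaleR[OF C_k_on_SucD(1)[OF Suc.prems(1)] C_k_on_SucD(1)[OF Suc.prems(2)]]])
    fix v
    show "C_k_on k S (\<lambda>x. f x *\<^sub>R frechet_derivative g (at x) v + frechet_derivative f (at x) v *\<^sub>R g x)"
      by (intro C_k_on_add[OF assms] Suc.IH C_k_on_SucD(2) Suc.prems C_k_on_Suc_D)
  qed
qed (simp add: continuous_on_scaleR)

text \<open>For a linear inner map the chain rule returns the same shape, the derivative of
  \<open>f\<close> in the fixed direction \<open>h v\<close> composed with \<open>h\<close>, so the
  induction closes. Restriction to the slice t = 0 is such a composition.\<close>

lemma C_k_on_compose_linear:
  assumes "open S" "bounded_linear h"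
  shows "C_k_on k S f \<Longrightarrow> C_k_on k (h -` S) (\<lambda>x. f (h x))"
proof (induction k arbitrary: f)
  case 0
  then show ?case
    by (auto intro!: continuous_on_compose2[of S f] simp: assms linear_continuous_on)
next
  case (Suc k)
  have o: "open (h -` S)"
    using assms by (intro open_vimage) (auto simp: linear_continuous_on)
  show ?case
  proof (rule C_k_on_SucI[OF o])
    fix x assume "x \<in> h -` S"
    then show "((\<lambda>x. f (h x)) has_derivative (\<lambda>v. frechet_derivative f (at (h x)) (h v))) (at x)"
      by (intro has_derivative_compose[OF bounded_linear_imp_has_derivative[OF assms(2)]]
          C_k_on_SucD(1)[OF Suc.prems]) simp
  next
    fix v
    show "C_k_on k (h -` S) (\<lambda>x. frechet_derivative f (at (h x)) (h v))"
      by (rule Suc.IH[OF C_k_on_SucD(2)[OF Suc.prems]])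
  qed
qed

lemma smooth_on_const: "open S \<Longrightarrow> smooth_on S (\<lambda>x. c)"
  and smooth_on_id: "open S \<Longrightarrow> smooth_on S (\<lambda>x. x)"
  and smooth_on_add:
    "open S \<Longrightarrow> smooth_on S f \<Longrightarrow> smooth_on S g \<Longrightarrow> smooth_on S (\<lambda>x. f x + g x)"
  and smooth_on_bounded_linear:
    "open S \<Longrightarrow> bounded_linear h \<Longrightarrow> smooth_on S f \<Longrightarrow> smooth_on S (\<lambda>x. h (f x))"
  and smooth_on_scaleR:
    "open S \<Longrightarrow> smooth_on S a \<Longrightarrow> smooth_on S f \<Longrightarrow> smooth_on S (\<lambda>x. a x *\<^sub>R f x)"
  and smooth_on_compose_linear:
    "open S \<Longrightarrow> bounded_linear l \<Longrightarrow> smooth_on S f \<Longrightarrow> smooth_on (l -` S) (\<lambda>x. f (l x))"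
  and smooth_on_cong:
    "open S \<Longrightarrow> (\<And>x. x \<in> S \<Longrightarrow> f x = g x) \<Longrightarrow> smooth_on S f \<Longrightarrow> smooth_on S g"
  unfolding smooth_on_def
  by (blast intro: C_k_on_const C_k_on_id C_k_on_add C_k_on_bounded_linear C_k_on_scaleR
      C_k_on_compose_linear C_k_on_cong)+

lemma smooth_on_scaleR_const:
  "open S \<Longrightarrow> smooth_on S f \<Longrightarrow> smooth_on S (\<lambda>x. (a::real) *\<^sub>R f x)"
  by (rule smooth_on_bounded_linear[OF _ bounded_linear_scaleR_right])

lemma smooth_on_diff:
  "open S \<Longrightarrow> smooth_on S f \<Longrightarrow> smooth_on S g \<Longrightarrow> smooth_on S (\<lambda>x. f x - g x)"
  using smooth_on_add[of S f "\<lambda>x. (-1) *\<^sub>R g x"] smooth_on_scaleR_const[of S g "-1"] by simp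

lemma smooth_on_sum:
  "open S \<Longrightarrow> (\<And>i. i \<in> I \<Longrightarrow> smooth_on S (f i)) \<Longrightarrow> smooth_on S (\<lambda>x. \<Sum>i\<in>I. f i x)"
  by (induction I rule: infinite_finite_induct) (auto intro: smooth_on_const smooth_on_add)

lemma smooth_on_imp_continuous_on: "smooth_on S f \<Longrightarrow> continuous_on S f"
  unfolding smooth_on_def by (metis C_k_on.simps(1))

lemma smooth_on_frechet:
  assumes "smooth_on S f"
  shows "x \<in> S \<Longrightarrow> (f has_derivative frechet_derivative f (at x)) (at x)"
    and "smooth_on S (\<lambda>x. frechet_derivative f (at x) v)"
  using assms C_k_on_SucD unfolding smooth_on_def by blast+

text \<open>Smoothness is tested on fixed directions. A direction that varies with the point is
  expanded in the basis, which turns the derivative into a sum of products of smooth maps.\<close>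

lemma smooth_on_frechet_apply:
  assumes "open S" "smooth_on S f" "smooth_on S h"
  shows "smooth_on S (\<lambda>x. frechet_derivative f (at x) (h x))"
proof (rule smooth_on_cong[OF assms(1)])
  show "smooth_on S (\<lambda>x. \<Sum>b\<in>Basis. (h x \<bullet> b) *\<^sub>R frechet_derivative f (at x) b)"
    using assms
    by (intro smooth_on_sum smooth_on_scaleR smooth_on_frechet(2)
        smooth_on_bounded_linear[OF _ bounded_linear_inner_left])
  fix x assume "x \<in> S"
  then interpret bounded_linear "frechet_derivative f (at x)"
    using smooth_on_frechet(1)[OF assms(2)] has_derivative_bounded_linear by blast
  show "(\<Sum>b\<in>Basis. (h x \<bullet> b) *\<^sub>R frechet_derivative f (at x) b) = frechet_derivative f (at x) (h x)"
    by (subst (2) euclidean_representation[of "h x", symmetric]) (simp add: sum scaleR)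
qed

text \<open>Continuity is available for each fixed direction only; by linearity the finitely many
  basis directions control all others.\<close>

lemma smooth_on_derivative_bound:
  assumes "smooth_on S f" "compact K" "K \<subseteq> S"
  obtains B where "B \<ge> 0" "\<And>x v. x \<in> K \<Longrightarrow> norm (frechet_derivative f (at x) v) \<le> B * norm v"
proof -
  have "bounded ((\<lambda>x. frechet_derivative f (at x) b) ` K)" for b
    using assms smooth_on_frechet(2) smooth_on_imp_continuous_on continuous_on_subset
    by (metis compact_continuous_image compact_imp_bounded)
  then have "\<exists>B. \<forall>x\<in>K. norm (frechet_derivative f (at x) b) \<le> B" for b
    by (simp add: bounded_iff)
  then obtain B where B: "\<And>b x. x \<in> K \<Longrightarrow> norm (frechet_derivative f (at x) b) \<le> B b"
    by metis
  have "norm (frechet_derivative f (at x) v) \<le> (\<Sum>b\<in>Basis. \<bar>B b\<bar>) * norm v" if "x \<in> K" for x v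
  proof -
    interpret bounded_linear "frechet_derivative f (at x)"
      using smooth_on_frechet(1)[OF assms(1)] has_derivative_bounded_linear that assms(3) by blast
    have "norm (frechet_derivative f (at x) v)
        = norm (\<Sum>b\<in>Basis. (v \<bullet> b) *\<^sub>R frechet_derivative f (at x) b)"
      by (subst euclidean_representation[of v, symmetric]) (simp only: sum scaleR)
    also have "\<dots> \<le> (\<Sum>b\<in>Basis. norm v * \<bar>B b\<bar>)"
    proof (intro sum_norm_le)
      fix b :: 'a assume "b \<in> Basis"
      then have "\<bar>v \<bullet> b\<bar> \<le> norm v" by (rule Basis_le_norm)
      moreover have "norm (frechet_derivative f (at x) b) \<le> \<bar>B b\<bar>"
        using B[OF that, of b] by linarith
      ultimately show "norm ((v \<bullet> b) *\<^sub>R frechet_derivative f (at x) b) \<le> norm v * \<bar>B b\<bar>"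
        by (simp add: mult_mono)
    qed
    finally show ?thesis by (simp add: sum_distrib_left mult.commute)
  qed
  then show ?thesis by (intro that[of "\<Sum>b\<in>Basis. \<bar>B b\<bar>"]) (auto intro: sum_nonneg)
qed

subsection \<open>Integral curves of small vector fields\<close>

text \<open>The integral curve is the fixed point of the Picard operator on continuous maps from the
  line to the ball; outside the time interval the curves are frozen at their end values.\<close>

lemma integral_curve_exists:
  fixes X :: "'a::euclidean_space \<Rightarrow> 'a"
  assumes r: "r \<ge> 0" and bnd: "\<And>y. y \<in> cball x r \<Longrightarrow> norm (X y) \<le> r"
    and lip: "\<And>y z. y \<in> cball x r \<Longrightarrow> z \<in> cball x r \<Longrightarrow> norm (X y - X z) \<le> norm (y - z) / 2"
  obtains c where "c (0::real) = x" "\<And>s. s \<in> {0..1} \<Longrightarrow> c s \<in> cball x r"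
    "\<And>s. s \<in> {0..1} \<Longrightarrow> (c has_vector_derivative X (c s)) (at s within {0..1})"
proof -
  have contX: "continuous_on (cball x r) X"
    unfolding continuous_on_iff
  proof (intro ballI allI impI)
    fix y e assume "y \<in> cball x r" "(0::real) < e"
    with lip show "\<exists>d>0. \<forall>z\<in>cball x r. dist z y < d \<longrightarrow> dist (X z) (X y) < e"
      by (intro exI[of _ e]) (force simp: dist_norm intro: order.strict_trans1)
  qed
  define \<sigma> where "\<sigma> s = max 0 (min 1 s)" for s :: real
  have \<sigma>: "\<sigma> s \<in> {0..1}" for s by (auto simp: \<sigma>_def)
  define B where "B = {u :: real \<Rightarrow>\<^sub>C 'a. \<forall>s. u s \<in> cball x r}"
  have intg: "(\<lambda>s. X (u s)) integrable_on {0..a}" if "u \<in> B" for u a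
    using that contX
    by (intro integrable_continuous_real continuous_on_compose2[OF contX]) (auto simp: B_def)
  define F where "F u s = x + integral {0..\<sigma> s} (\<lambda>s. X (apply_bcontfun u s))" for u s
  have F_ball: "F u s \<in> cball x r" if "u \<in> B" for u s
  proof -
    have "norm (integral {0..\<sigma> s} (\<lambda>s. X (apply_bcontfun u s))) \<le> r * (\<sigma> s - 0)"
      using that \<sigma>[of s] bnd contX
      by (intro integral_bound continuous_on_compose2[OF contX]) (auto simp: B_def)
    also have "\<dots> \<le> r * 1" using \<sigma>[of s] r by (intro mult_left_mono) auto
    finally show ?thesis by (simp add: F_def dist_norm)
  qed
  have F_cont: "continuous_on UNIV (F u)" if "u \<in> B" for u
  proof -
    have "continuous_on {0..1} (\<lambda>s. integral {0..s} (\<lambda>s. X (apply_bcontfun u s)))"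
      by (rule indefinite_integral_continuous_1[OF intg[OF that]])
    moreover have "continuous_on UNIV \<sigma>" unfolding \<sigma>_def by (intro continuous_intros)
    ultimately have "continuous_on UNIV (\<lambda>s. integral {0..\<sigma> s} (\<lambda>s. X (apply_bcontfun u s)))"
      by (rule continuous_on_compose2) (use \<sigma> in blast)
    then show ?thesis unfolding F_def by (intro continuous_on_add continuous_on_const)
  qed
  have F_bcont: "F u \<in> bcontfun" if "u \<in> B" for u
  proof -
    have "range (F u) \<subseteq> cball x r" using F_ball[OF that] by blast
    then show ?thesis
      using F_cont[OF that] bounded_subset[OF bounded_cball] by (simp add: bcontfun_def)
  qed
  have F_app: "apply_bcontfun (Bcontfun (F u)) = F u" if "u \<in> B" for u
    using F_bcont[OF that] by (rule Bcontfun_inverse)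
  have "\<exists>!u. u \<in> B \<and> Bcontfun (F u) = u"
  \<comment> \<open>The factor 1/2 is the Lipschitz constant of \<open>X\<close> times an
    integration length of at most 1.\<close>
  proof (rule Banach_fix[where c = "1/2"])
    have "B = PiC UNIV (\<lambda>_. cball x r)" by (auto simp: B_def mem_PiC_iff Pi_def)
    then have "closed B" by (simp add: closed_PiC)
    then show "complete B" by (simp add: complete_eq_closed)
    have "const_bcontfun x \<in> B" using r by (simp add: B_def const_bcontfun.rep_eq)
    then show "B \<noteq> {}" by auto
    show "(\<lambda>u. Bcontfun (F u)) ` B \<subseteq> B" using F_ball F_app by (auto simp: B_def)
  next
    fix u v assume uv: "u \<in> B" "v \<in> B"
    show "dist (Bcontfun (F u)) (Bcontfun (F v)) \<le> 1/2 * dist u v"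
    proof (rule dist_bound)
      fix s
      have "norm (integral {0..\<sigma> s} (\<lambda>s. X (u s) - X (v s))) \<le> (dist u v / 2) * (\<sigma> s - 0)"
      proof (rule integral_bound)
        show "continuous_on {0..\<sigma> s} (\<lambda>s. X (u s) - X (v s))"
          using uv by (intro continuous_on_diff continuous_on_compose2[OF contX]) (auto simp: B_def)
        fix p
        have "norm (X (u p) - X (v p)) \<le> norm (u p - v p) / 2"
          using uv by (intro lip) (auto simp: B_def)
        then show "norm (X (u p) - X (v p)) \<le> dist u v / 2"
          using dist_bounded[of u p v] by (simp add: dist_norm)
      qed (use \<sigma>[of s] in auto)
      also have "\<dots> \<le> (dist u v / 2) * 1" using \<sigma>[of s] by (intro mult_left_mono) auto
      finally show "dist (Bcontfun (F u) s) (Bcontfun (F v) s) \<le> 1/2 * dist u v"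
        using uv by (simp add: F_app F_def dist_norm integral_diff[OF intg intg])
    qed
  qed auto
  then obtain u where u: "u \<in> B" "Bcontfun (F u) = u" by blast
  then have fp: "u s = F u s" for s using F_app by metis
  show ?thesis
  proof (rule that[of u])
    show "apply_bcontfun u 0 = x" by (subst fp) (simp add: F_def \<sigma>_def)
    show "apply_bcontfun u s \<in> cball x r" for s using u by (simp add: B_def)
    fix s :: real assume s: "s \<in> {0..1}"
    have "((\<lambda>s. integral {0..s} (\<lambda>s. X (u s))) has_vector_derivative X (u s)) (at s within {0..1})"
      using u s contX
      by (intro integral_has_vector_derivative continuous_on_compose2[OF contX]) (auto simp: B_def)
    then have "((\<lambda>s. x + integral {0..s} (\<lambda>s. X (u s))) has_vector_derivative X (u s)) (at s within {0..1})"
      by (simp add: has_vector_derivative_add_const add.commute[of x])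
    \<comment> \<open>On the unit interval \<sigma> is the identity, so there the fixed point equals
      the integral just differentiated.\<close>
    then show "(apply_bcontfun u has_vector_derivative X (u s)) (at s within {0..1})"
      by (rule has_vector_derivative_transform_within[OF _ zero_less_one s])
        (subst fp, simp add: F_def \<sigma>_def)
  qed
qed

lemma curve_continuous_on:
  assumes "\<And>s. s \<in> S \<Longrightarrow> (c has_vector_derivative c' s) (at s within S)"
  shows "continuous_on S c"
  using assms has_vector_derivative_continuous by (blast intro: continuous_on_eq_continuous_within[THEN iffD2])

text \<open>The speed bound stops short of the final time \<open>s\<close>, so that the estimate
  applies up to a first exit time, at which no bound has been established yet.\<close>

lemma integral_curve_norm_diff_bound:
  fixes c :: "real \<Rightarrow> 'a::real_normed_vector"
  assumes "0 \<le> s"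
    and "\<And>p. p \<in> {0..s} \<Longrightarrow> (c has_vector_derivative c' p) (at p within {0..s})"
    and "\<And>p. p \<in> {0..<s} \<Longrightarrow> norm (c' p) \<le> B"
  shows "norm (c s - c 0) \<le> B * s"
proof (cases "s = 0")
  case False
  have "norm (c s - c 0) \<le> B * s - B * 0"
  proof (rule differentiable_bound_general[where f' = c' and \<phi>' = "\<lambda>_. B"])
    show "0 < s" using False assms(1) by simp
    show "continuous_on {0..s} c"
      by (rule curve_continuous_on[OF assms(2)])
    fix p assume p: "0 < p" "p < s"
    then show "(c has_vector_derivative c' p) (at p)"
      using assms(2)[of p] at_within_Icc_at[of 0 p s] by simp
    show "norm (c' p) \<le> B" using p assms(3) by simp
    show "((\<lambda>s. B * s) has_vector_derivative B) (at p)"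
      by (auto intro!: derivative_eq_intros simp: has_real_derivative_iff_has_vector_derivative[symmetric])
  qed (auto intro!: continuous_intros)
  then show ?thesis by simp
qed simp

text \<open>First exit argument: before the first time at distance at least \<open>r\<close> the
  speed is at most \<open>r / 2\<close>, so within unit time the displacement is at most
  \<open>r / 2\<close>, a contradiction. The half provides the strict inequality.\<close>

lemma integral_curve_in_cball:
  fixes c :: "real \<Rightarrow> 'a::euclidean_space"
  assumes c: "\<And>s. s \<in> {0..1} \<Longrightarrow> (c has_vector_derivative X (c s)) (at s within {0..1})"
    and r: "r > 0" and bnd: "\<And>y. y \<in> cball (c 0) r \<Longrightarrow> norm (X y) \<le> r / 2"
    and s: "s \<in> {0..1}"
  shows "c s \<in> cball (c 0) r"
proof (rule ccontr)
  assume "c s \<notin> cball (c 0) r"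
  \<comment> \<open>The non-strict inequality makes \<open>A\<close> closed, so the first exit time
    \<open>Inf A\<close> is attained.\<close>
  define A where "A = {p \<in> {0..1}. dist (c 0) (c p) \<ge> r}"
  have cc: "continuous_on {0..1} c" by (rule curve_continuous_on[OF c])
  then have "closed A" unfolding A_def
    by (intro continuous_on_closed_Collect_le continuous_intros) auto
  moreover have "s \<in> A" using s \<open>c s \<notin> _\<close> by (auto simp: A_def)
  moreover have bdd: "bdd_below A" by (intro bdd_belowI[of _ 0]) (auto simp: A_def)
  ultimately have m: "Inf A \<in> A" by (intro closed_contains_Inf) auto
  have "norm (c (Inf A) - c 0) \<le> r / 2 * Inf A"
  proof (rule integral_curve_norm_diff_bound)
    show "0 \<le> Inf A" using m by (simp add: A_def)
    fix p
    { assume "p \<in> {0..Inf A}"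
      then show "(c has_vector_derivative X (c p)) (at p within {0..Inf A})"
        using m by (intro has_vector_derivative_within_subset[OF c]) (auto simp: A_def) }
    assume p: "p \<in> {0..<Inf A}"
    then have "p \<notin> A" using cInf_lower[OF _ bdd, of p] by auto
    then show "norm (X (c p)) \<le> r / 2" using p m by (intro bnd) (auto simp: A_def)
  qed
  also have "\<dots> \<le> r / 2 * 1" using m r by (intro mult_left_mono) (auto simp: A_def)
  finally show False using m r by (simp add: A_def dist_norm norm_minus_commute)
qed

text \<open>At a time \<open>m\<close> of maximal distance, the mean value bound says that this
  distance is at most half of itself times \<open>m\<close>, where m \<le> 1. So the maximum is
  0.\<close>

lemma integral_curve_unique:
  fixes c d :: "real \<Rightarrow> 'a::euclidean_space"
  assumes c: "\<And>s. s \<in> {0..1} \<Longrightarrow> (c has_vector_derivative X (c s)) (at s within {0..1})"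
    and d: "\<And>s. s \<in> {0..1} \<Longrightarrow> (d has_vector_derivative X (d s)) (at s within {0..1})"
    and "c 0 = d 0"
    and lip: "\<And>s. s \<in> {0..1} \<Longrightarrow> norm (X (c s) - X (d s)) \<le> norm (c s - d s) / 2"
    and s: "s \<in> {0..1}"
  shows "c s = d s"
proof -
  have "continuous_on {0..1} c" "continuous_on {0..1} d"
    using curve_continuous_on[OF c] curve_continuous_on[OF d] by auto
  then have "continuous_on {0..1} (\<lambda>s. norm (c s - d s))" by (intro continuous_intros)
  then obtain m where m: "m \<in> {0..1}" "\<And>p. p \<in> {0..1} \<Longrightarrow> norm (c p - d p) \<le> norm (c m - d m)"
    using continuous_attains_sup[of "{0..1::real}" "\<lambda>s. norm (c s - d s)"] by auto
  have "norm ((c m - d m) - (c 0 - d 0)) \<le> norm (c m - d m) / 2 * m"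
  proof (rule integral_curve_norm_diff_bound)
    fix p
    { assume "p \<in> {0..m}"
      then show "((\<lambda>s. c s - d s) has_vector_derivative X (c p) - X (d p)) (at p within {0..m})"
        using m(1)
        by (intro has_vector_derivative_diff has_vector_derivative_within_subset[OF c]
            has_vector_derivative_within_subset[OF d]) auto }
    assume "p \<in> {0..<m}"
    then show "norm (X (c p) - X (d p)) \<le> norm (c m - d m) / 2"
      using lip[of p] m(2)[of p] m(1) by auto
  qed (use m in auto)
  also have "\<dots> \<le> norm (c m - d m) / 2 * 1" using m(1) by (intro mult_left_mono) auto
  finally have "norm (c m - d m) = 0" using \<open>c 0 = d 0\<close> by auto
  then show ?thesis using m(2)[OF s] by auto
qed

text \<open>The definite description in \<open>exp_vf\<close> asks for uniqueness among all curves
  in \<open>U\<close>, whereas the Lipschitz bound holds on the ball only. The exit argument first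
  confines every competitor to the ball.\<close>

lemma exp_vf_eq:
  fixes X :: "'a::euclidean_space \<Rightarrow> 'a"
  assumes r: "r > 0" and bnd: "\<And>y. y \<in> cball x r \<Longrightarrow> norm (X y) \<le> r / 2"
    and lip: "\<And>y z. y \<in> cball x r \<Longrightarrow> z \<in> cball x r \<Longrightarrow> norm (X y - X z) \<le> norm (y - z) / 2"
    and U: "cball x r \<subseteq> U"
  obtains c where "exp_vf_defined U X x" "exp_vf U X x = c (1::real)" "c 0 = x"
    "\<And>s. s \<in> {0..1} \<Longrightarrow> c s \<in> cball x r"
    "\<And>s. s \<in> {0..1} \<Longrightarrow> (c has_vector_derivative X (c s)) (at s within {0..1})"
proof -
  have bnd': "norm (X y) \<le> r" if "y \<in> cball x r" for y
    using bnd[OF that] r by linarith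
  obtain c where c: "c (0::real) = x" "\<And>s. s \<in> {0..1} \<Longrightarrow> c s \<in> cball x r"
    "\<And>s. s \<in> {0..1} \<Longrightarrow> (c has_vector_derivative X (c s)) (at s within {0..1})"
    using integral_curve_exists[OF less_imp_le[OF r] bnd' lip] by blast
  then have e: "has_exp_vf U X x (c 1)" using U unfolding has_exp_vf_def by blast
  moreover have "y = c 1" if "has_exp_vf U X x y" for y
  proof -
    from that obtain d where d: "d 0 = x" "d 1 = y"
      "\<And>s. s \<in> {0..1} \<Longrightarrow> (d has_vector_derivative X (d s)) (at s within {0..1})"
      unfolding has_exp_vf_def by blast
    have db: "d s \<in> cball x r" if "s \<in> {0..1}" for s
      using integral_curve_in_cball[OF d(3) r _ that] bnd d(1) by simp
    have "d 1 = c 1"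
    proof (rule integral_curve_unique[where X = X])
      show "norm (X (d s) - X (c s)) \<le> norm (d s - c s) / 2" if "s \<in> {0..1}" for s
        by (rule lip[OF db[OF that] c(2)[OF that]])
    qed (use c(1,3) d(1,3) in simp_all)
    then show ?thesis using d(2) by simp
  qed
  ultimately have "exp_vf U X x = c 1" unfolding exp_vf_def by blast
  then show ?thesis using that c e unfolding exp_vf_defined_def by blast
qed

subsection \<open>Expansion along an integral curve\<close>

lemma mi_order_0 [simp]: "mi_order 0 = 0"
  by (simp add: mi_order_def)

lemma mi_order_eq_0_iff: "mi_order \<alpha> = 0 \<longleftrightarrow> \<alpha> = 0"
  by (auto simp: mi_order_def vec_eq_iff)

lemma mi_order_pos_iff: "0 < mi_order \<alpha> \<longleftrightarrow> \<alpha> \<noteq> 0"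
  by (simp add: mi_order_eq_0_iff flip: neq0_conv)

lemma mi_order_add: "mi_order (\<alpha> + \<beta>) = mi_order \<alpha> + mi_order \<beta>"
  by (simp add: mi_order_def sum.distrib)

lemma mi_power_0 [simp]: "mi_power t 0 = 1"
  by (simp add: mi_power_def)

lemma mi_power_add: "mi_power t (\<alpha> + \<beta>) = mi_power t \<alpha> * mi_power t \<beta>"
  by (simp add: mi_power_def power_add prod.distrib)

lemma mi_power_axis: "mi_power t (axis i 1) = t $ i"
proof -
  have "mi_power t (axis i 1) = (\<Prod>j\<in>UNIV. if j = i then t $ j else 1)"
    unfolding mi_power_def axis_def by (intro prod.cong) auto
  then show ?thesis by simp
qed

lemma mi_power_scaleR: "mi_power (r *\<^sub>R t) \<alpha> = r ^ mi_order \<alpha> * mi_power t \<alpha>"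
  by (simp add: mi_power_def mi_order_def power_mult_distrib prod.distrib power_sum)

lemma abs_mi_power_le: "\<bar>mi_power t \<alpha>\<bar> \<le> norm t ^ mi_order \<alpha>"
  unfolding mi_power_def mi_order_def power_sum abs_prod
  by (intro prod_mono) (auto simp: power_abs component_le_norm_cart power_mono)

lemma abs_mi_power_le_power:
  assumes "norm t \<le> 1" "N \<le> mi_order \<alpha>"
  shows "\<bar>mi_power t \<alpha>\<bar> \<le> norm t ^ N"
  using abs_mi_power_le[of t \<alpha>] power_decreasing[OF assms(2) norm_ge_zero assms(1)] by linarith

lemma finite_mi_order_le: "finite {\<alpha> :: nat ^ 'k::finite. mi_order \<alpha> \<le> n}"
proof (rule finite_subset)
  show "{\<alpha> :: nat ^ 'k. mi_order \<alpha> \<le> n} \<subseteq> vec_lambda ` (UNIV \<rightarrow>\<^sub>E {..n})"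
  proof
    fix \<alpha> :: "nat ^ 'k" assume "\<alpha> \<in> {\<alpha>. mi_order \<alpha> \<le> n}"
    then have "\<alpha> $ i \<le> n" for i
      using member_le_sum[of i UNIV "\<lambda>i. \<alpha> $ i"] by (simp add: mi_order_def)
    then show "\<alpha> \<in> vec_lambda ` (UNIV \<rightarrow>\<^sub>E {..n})"
      by (intro image_eqI[of _ _ "vec_nth \<alpha>"]) auto
  qed
qed (simp add: finite_PiE)

lemma finite_mi_order_less: "finite {\<alpha> :: nat ^ 'k::finite. mi_order \<alpha> < n}"
  by (rule finite_subset[OF _ finite_mi_order_le[of n]]) auto

lemma finite_mi_order_between: "finite {\<alpha> :: nat ^ 'k::finite. 0 < mi_order \<alpha> \<and> mi_order \<alpha> < n}"
  by (rule finite_subset[OF _ finite_mi_order_le[of n]]) auto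

lemma finite_mi_sum: "finite {(\<beta>, \<delta>). \<beta> \<noteq> 0 \<and> \<beta> + \<delta> = (\<alpha> :: nat ^ 'k::finite)}"
  by (rule finite_subset[OF _ finite_cartesian_product[OF finite_mi_order_le[of "mi_order \<alpha>"]
          finite_mi_order_le[of "mi_order \<alpha>"]]])
    (auto simp: mi_order_add)

text \<open>\<open>lie_coeff Z f j \<alpha>\<close> is the coefficient of \<open>t^\<alpha>\<close> in \<open>Z_t (\<dots> (Z_t f))\<close> (\<open>j\<close> factors), where
  \<open>Z_t\<close> is the derivation along the formal vector field \<open>\<Sum>\<beta>\<noteq>0. t^\<beta> Z \<beta>\<close>, so that \<open>exp_coeff Z f \<alpha>\<close> is the
  coefficient of \<open>t^\<alpha>\<close> in \<open>f \<circ> exp Z_t\<close>. The sum over \<open>j\<close> stops at \<open>|\<alpha>|\<close> because \<open>Z_t\<close> has no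
  constant term.\<close>

primrec lie_coeff ::
  "(nat ^ 'k::finite \<Rightarrow> 'a::euclidean_space \<Rightarrow> 'a) \<Rightarrow> ('a \<Rightarrow> 'b::euclidean_space) \<Rightarrow> nat \<Rightarrow>
     nat ^ 'k \<Rightarrow> 'a \<Rightarrow> 'b" where
  "lie_coeff Z f 0 = (\<lambda>\<alpha>. if \<alpha> = 0 then f else (\<lambda>x. 0))"
| "lie_coeff Z f (Suc j) = (\<lambda>\<alpha> x. \<Sum>(\<beta>, \<delta>) | \<beta> \<noteq> 0 \<and> \<beta> + \<delta> = \<alpha>.
     frechet_derivative (lie_coeff Z f j \<delta>) (at x) (Z \<beta> x))"

definition exp_coeff ::
  "(nat ^ 'k::finite \<Rightarrow> 'a::euclidean_space \<Rightarrow> 'a) \<Rightarrow> ('a \<Rightarrow> 'b::euclidean_space) \<Rightarrow>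
     nat ^ 'k \<Rightarrow> 'a \<Rightarrow> 'b" where
  "exp_coeff Z f \<alpha> x = (\<Sum>j\<le>mi_order \<alpha>. (1 / fact j) *\<^sub>R lie_coeff Z f j \<alpha> x)"

section \<open>Vanishing, smoothness and locality of the expansion coefficients\<close>

lemma frechet_derivative_zero [simp]: "frechet_derivative (\<lambda>x. 0) (at x) v = 0"
  by (simp add: frechet_derivative_const)

lemma lie_coeff_eq_0: "mi_order \<alpha> < j \<Longrightarrow> lie_coeff Z f j \<alpha> = (\<lambda>x. 0)"
proof (induction j arbitrary: \<alpha>)
  case (Suc j)
  have "frechet_derivative (lie_coeff Z f j \<delta>) (at x) (Z \<beta> x) = 0"
    if "\<beta> \<noteq> 0" "\<beta> + \<delta> = \<alpha>" for \<beta> \<delta> x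
  proof -
    have "mi_order \<delta> < j"
      using Suc.prems that mi_order_add[of \<beta> \<delta>] mi_order_pos_iff[of \<beta>] by simp
    then show ?thesis using Suc.IH[of \<delta>] by simp
  qed
  then show ?case by (auto intro!: sum.neutral)
qed simp

lemma smooth_on_lie_coeff:
  assumes "open S" "smooth_on S f" "\<And>\<beta>. \<beta> \<noteq> 0 \<Longrightarrow> smooth_on S (Z \<beta>)"
  shows "smooth_on S (lie_coeff Z f j \<alpha>)"
proof (induction j arbitrary: \<alpha>)
  case (Suc j)
  show ?case unfolding lie_coeff.simps
    by (rule smooth_on_sum[OF assms(1)]) (auto intro: smooth_on_frechet_apply assms Suc)
qed (use assms in \<open>auto intro: smooth_on_const\<close>)

lemma smooth_on_exp_coeff:
  assumes "open S" "smooth_on S f" "\<And>\<beta>. \<beta> \<noteq> 0 \<Longrightarrow> smooth_on S (Z \<beta>)"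
  shows "smooth_on S (exp_coeff Z f \<alpha>)"
  unfolding exp_coeff_def
  by (intro smooth_on_sum smooth_on_scaleR_const smooth_on_lie_coeff assms)

text \<open>Agreement is required on an open set because each step differentiates the previous
  coefficients. Both parts of a splitting of \<alpha> have order at most that of \<alpha>, so the
  threshold \<open>m\<close> passes through the induction.\<close>

lemma lie_coeff_local:
  assumes "open T" and "\<And>\<beta> x. 0 < mi_order \<beta> \<Longrightarrow> mi_order \<beta> < m \<Longrightarrow> x \<in> T \<Longrightarrow> Z \<beta> x = Z' \<beta> x"
  shows "mi_order \<alpha> < m \<Longrightarrow> x \<in> T \<Longrightarrow> lie_coeff Z f j \<alpha> x = lie_coeff Z' f j \<alpha> x"
proof (induction j arbitrary: \<alpha> x)
  case (Suc j)
  have "frechet_derivative (lie_coeff Z f j \<delta>) (at x) (Z \<beta> x) =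
        frechet_derivative (lie_coeff Z' f j \<delta>) (at x) (Z' \<beta> x)"
    if "\<beta> \<noteq> 0" "\<beta> + \<delta> = \<alpha>" for \<beta> \<delta>
  proof -
    have "mi_order \<delta> < m" "mi_order \<beta> < m" "0 < mi_order \<beta>"
      using Suc.prems that mi_order_add[of \<beta> \<delta>] by (auto simp: mi_order_pos_iff)
    then show ?thesis
      using frechet_derivative_cong_open[OF assms(1) Suc.prems(2) Suc.IH[of \<delta>]] assms(2) Suc.prems
      by simp
  qed
  then show ?case by (auto intro!: sum.cong)
qed simp

text \<open>From the second order on, \<open>lie_coeff Z f j \<alpha>\<close> involves only the fields of order less than
  \<open>|\<alpha>|\<close>, which makes the equations for the fields triangular.\<close>

lemma lie_coeff_local_2:
  assumes "open T" and "\<And>\<beta> x. 0 < mi_order \<beta> \<Longrightarrow> mi_order \<beta> < mi_order \<alpha> \<Longrightarrow> x \<in> T \<Longrightarrow> Z \<beta> x = Z' \<beta> x"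
    and "j \<ge> 2" "x \<in> T"
  shows "lie_coeff Z f j \<alpha> x = lie_coeff Z' f j \<alpha> x"
proof -
  obtain i where j: "j = Suc i" "i > 0" using assms(3) by (cases j) auto
  have "frechet_derivative (lie_coeff Z f i \<delta>) (at x) (Z \<beta> x) =
        frechet_derivative (lie_coeff Z' f i \<delta>) (at x) (Z' \<beta> x)"
    if "\<beta> \<noteq> 0" "\<beta> + \<delta> = \<alpha>" for \<beta> \<delta>
  \<comment> \<open>The field with \<beta> = \<alpha> occurs only next to \<delta> = 0, where the
    coefficient for \<open>i > 0\<close> factors is the zero map.\<close>
  proof (cases "\<delta> = 0")
    case True
    then show ?thesis using j by (simp add: lie_coeff_eq_0)
  next
    case False
    then have "mi_order \<delta> < mi_order \<alpha>" "mi_order \<beta> < mi_order \<alpha>" "0 < mi_order \<beta>"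
      using that mi_order_add[of \<beta> \<delta>] by (auto simp: mi_order_pos_iff)
    moreover have "frechet_derivative (lie_coeff Z f i \<delta>) (at x) = frechet_derivative (lie_coeff Z' f i \<delta>) (at x)"
      by (rule frechet_derivative_cong_open[OF assms(1,4)])
        (rule lie_coeff_local[OF assms(1,2)], use calculation in auto)
    ultimately show ?thesis using assms(2,4) by simp
  qed
  then show ?thesis unfolding j by (auto intro!: sum.cong)
qed

text \<open>The term j = 1 is \<open>Z \<alpha>\<close>, since the derivative of the identity in a
  direction is that direction; the term j = 0 vanishes because \<alpha> is nonzero. This is the unit
  diagonal of the triangular system.\<close>

lemma exp_coeff_id:
  assumes "\<alpha> \<noteq> 0"
  shows "exp_coeff Z (\<lambda>x. x) \<alpha> x =
    Z \<alpha> x + (\<Sum>j = 2..mi_order \<alpha>. (1 / fact j) *\<^sub>R lie_coeff Z (\<lambda>x. x) j \<alpha> x)"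
proof -
  \<comment> \<open>Only the splitting with \<delta> = 0 contributes: with no factor applied, all
    other coefficients of the identity are zero maps.\<close>
  have "{(\<beta>, \<delta>). \<beta> \<noteq> 0 \<and> \<beta> + \<delta> = \<alpha>} = insert (\<alpha>, 0) {(\<beta>, \<delta>). \<beta> \<noteq> 0 \<and> \<delta> \<noteq> 0 \<and> \<beta> + \<delta> = \<alpha>}"
    using assms by auto
  moreover have "finite {(\<beta>, \<delta>). \<beta> \<noteq> 0 \<and> \<delta> \<noteq> 0 \<and> \<beta> + \<delta> = \<alpha>}"
    by (rule finite_subset[OF _ finite_mi_sum[of \<alpha>]]) auto
  moreover have "frechet_derivative (\<lambda>x. x) (at x) = (\<lambda>v. v)"
    by (metis frechet_derivative_at has_derivative_ident)
  moreover have "(\<Sum>(\<beta>, \<delta>) | \<beta> \<noteq> 0 \<and> \<delta> \<noteq> 0 \<and> \<beta> + \<delta> = \<alpha>.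
      frechet_derivative (lie_coeff Z (\<lambda>x. x) 0 \<delta>) (at x) (Z \<beta> x)) = 0"
    by (rule sum.neutral) auto
  ultimately have 1: "lie_coeff Z (\<lambda>x. x) (Suc 0) \<alpha> x = Z \<alpha> x"
    by (simp add: lie_coeff.simps(2)[where j = 0] del: lie_coeff.simps(2))
  have "{..mi_order \<alpha>} = insert 0 (insert 1 {2..mi_order \<alpha>})"
    using assms mi_order_pos_iff[of \<alpha>] by auto
  then show ?thesis using 1 assms unfolding exp_coeff_def by simp
qed

lemma exp_coeff_0: "exp_coeff Z f 0 x = f x"
  by (simp add: exp_coeff_def)

text \<open>Padding with vanishing terms gives all \<alpha> the same range of \<open>j\<close>,
  which permits the exchange of sums in the remainder estimate.\<close>

lemma exp_coeff_extend:
  assumes "mi_order \<alpha> < N"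
  shows "(\<Sum>j<N. (1 / fact j) *\<^sub>R lie_coeff Z f j \<alpha> x) = exp_coeff Z f \<alpha> x"
  unfolding exp_coeff_def using assms lie_coeff_eq_0[of \<alpha> _ Z f]
  by (intro sum.mono_neutral_right) auto

text \<open>The sum \<open>\<Sum>j<N. (1 - s)^j / j! u_j(s)\<close>, with \<open>u_j\<close> the truncation of \<open>Z_t\<dots>Z_t f\<close> (\<open>j\<close> factors)
  along the curve, interpolates between the truncated expansion at the start of the curve and the value
  of \<open>f\<close> at its end. Since \<open>u_j' = u_{j+1} + O(|t|^N)\<close>, its derivative telescopes to \<open>O(|t|^N)\<close>.\<close>

lemma exp_coeff_expansion:
  fixes Z :: "nat ^ 'k::finite \<Rightarrow> 'a::euclidean_space \<Rightarrow> 'a" and f :: "'a \<Rightarrow> 'b::euclidean_space"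
  assumes "open S" "smooth_on S f" "\<And>\<beta>. \<beta> \<noteq> 0 \<Longrightarrow> smooth_on S (Z \<beta>)"
    and K: "compact K" "K \<subseteq> S" and NM: "1 \<le> N" "N \<le> M"
  shows "\<exists>C. \<forall>c t. norm t \<le> 1 \<longrightarrow>
      (\<forall>s\<in>{0..1}. c s \<in> K \<and> (c has_vector_derivative
         (\<Sum>\<beta> | 0 < mi_order \<beta> \<and> mi_order \<beta> < M. mi_power t \<beta> *\<^sub>R Z \<beta> (c s))) (at s within {0..1})) \<longrightarrow>
      norm (f (c 1) - (\<Sum>\<alpha> | mi_order \<alpha> < N. mi_power t \<alpha> *\<^sub>R exp_coeff Z f \<alpha> (c 0))) \<le> C * norm t ^ N"
proof -
  let ?B = "{\<beta> :: nat ^ 'k. 0 < mi_order \<beta> \<and> mi_order \<beta> < M}"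
  let ?I = "{\<alpha> :: nat ^ 'k. mi_order \<alpha> < N}"
  define E where "E = lie_coeff Z f"
  define G where "G j \<beta> \<delta> x = frechet_derivative (E j \<delta>) (at x) (Z \<beta> x)" for j \<beta> \<delta> x
  \<comment> \<open>The splittings beyond the cutoff \<open>N\<close> that arise when the truncated
    field acts on a truncated series; they make up the remainder.\<close>
  define P where "P = {(\<beta>, \<delta>). \<beta> \<in> ?B \<and> \<delta> \<in> ?I \<and> N \<le> mi_order (\<beta> + \<delta>)}"
  have finB: "finite ?B" and finI: "finite ?I"
    using finite_mi_order_between finite_mi_order_less by blast+
  have finP: "finite P"
    by (rule finite_subset[OF _ finite_cartesian_product[OF finB finI]]) (auto simp: P_def)
  have smE: "smooth_on S (E j \<delta>)" for j \<delta>
    unfolding E_def by (rule smooth_on_lie_coeff[OF assms(1-3)])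
  have "\<exists>C. \<forall>x\<in>K. norm (G j \<beta> \<delta> x) \<le> C" if "\<beta> \<noteq> 0" for j \<beta> \<delta>
  proof -
    have "smooth_on S (G j \<beta> \<delta>)"
      unfolding G_def by (rule smooth_on_frechet_apply[OF assms(1) smE assms(3)[OF that]])
    then have "continuous_on K (G j \<beta> \<delta>)"
      using K smooth_on_imp_continuous_on continuous_on_subset by blast
    then have "bounded (G j \<beta> \<delta> ` K)" using K compact_continuous_image compact_imp_bounded by blast
    then show ?thesis by (simp add: bounded_iff)
  qed
  \<comment> \<open>The bounds are chosen before the curve and \<open>t\<close> are fixed, so the
    final constant is uniform in both.\<close>
  moreover define C where "C j \<beta> \<delta> = (SOME C. \<forall>x\<in>K. norm (G j \<beta> \<delta> x) \<le> C)" for j \<beta> \<delta>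
  ultimately have C: "norm (G j \<beta> \<delta> x) \<le> C j \<beta> \<delta>" if "\<beta> \<noteq> 0" "x \<in> K" for j \<beta> \<delta> x
    using someI_ex[of "\<lambda>C. \<forall>x\<in>K. norm (G j \<beta> \<delta> x) \<le> C"] that by simp
  show ?thesis
  proof (intro exI allI impI)
    fix c and t :: "real ^ 'k"
    assume t: "norm t \<le> 1" and "\<forall>s\<in>{0..1}. c s \<in> K \<and> (c has_vector_derivative
         (\<Sum>\<beta> | 0 < mi_order \<beta> \<and> mi_order \<beta> < M. mi_power t \<beta> *\<^sub>R Z \<beta> (c s))) (at s within {0..1})"
    then have c: "c s \<in> K \<and> (c has_vector_derivative
         (\<Sum>\<beta> | 0 < mi_order \<beta> \<and> mi_order \<beta> < M. mi_power t \<beta> *\<^sub>R Z \<beta> (c s))) (at s within {0..1})"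
      if "s \<in> {0..1}" for s
      using that by blast
    define u where "u j s = (\<Sum>\<alpha>\<in>?I. mi_power t \<alpha> *\<^sub>R E j \<alpha> (c s))" for j s
    define R where "R j s = (\<Sum>(\<beta>, \<delta>)\<in>P. mi_power t (\<beta> + \<delta>) *\<^sub>R G j \<beta> \<delta> (c s))" for j s
    have u': "(u j has_vector_derivative u (Suc j) s + R j s) (at s within {0..1})"
      if s: "s \<in> {0..1}" for j s
    proof -
      let ?v = "\<Sum>\<beta>\<in>?B. mi_power t \<beta> *\<^sub>R Z \<beta> (c s)"
      have "((\<lambda>s. E j \<delta> (c s)) has_vector_derivative frechet_derivative (E j \<delta>) (at (c s)) ?v)
          (at s within {0..1})" for \<delta>
        using vector_derivative_diff_chain_within[of c ?v s "{0..1}" "E j \<delta>"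
            "frechet_derivative (E j \<delta>) (at (c s))"] c[OF s] K
          has_derivative_at_withinI[OF smooth_on_frechet(1)[OF smE]]
        by (auto simp: o_def)
      then have 1: "(u j has_vector_derivative
          (\<Sum>\<delta>\<in>?I. mi_power t \<delta> *\<^sub>R frechet_derivative (E j \<delta>) (at (c s)) ?v)) (at s within {0..1})"
        unfolding u_def
        by (intro has_vector_derivative_sum
            bounded_linear.has_vector_derivative[OF bounded_linear_scaleR_right])
      have "(\<Sum>\<delta>\<in>?I. mi_power t \<delta> *\<^sub>R frechet_derivative (E j \<delta>) (at (c s)) ?v)
          = (\<Sum>\<delta>\<in>?I. \<Sum>\<beta>\<in>?B. mi_power t (\<beta> + \<delta>) *\<^sub>R G j \<beta> \<delta> (c s))"
      proof (rule sum.cong[OF refl])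
        fix \<delta>
        interpret bounded_linear "frechet_derivative (E j \<delta>) (at (c s))"
          using smooth_on_frechet(1)[OF smE] has_derivative_bounded_linear c[OF s] K by blast
        show "mi_power t \<delta> *\<^sub>R frechet_derivative (E j \<delta>) (at (c s)) ?v
            = (\<Sum>\<beta>\<in>?B. mi_power t (\<beta> + \<delta>) *\<^sub>R G j \<beta> \<delta> (c s))"
          by (simp add: sum scaleR scaleR_sum_right mi_power_add G_def mult.commute)
      qed
      also have "\<dots> = (\<Sum>(\<beta>, \<delta>)\<in>?B \<times> ?I. mi_power t (\<beta> + \<delta>) *\<^sub>R G j \<beta> \<delta> (c s))"
        by (subst sum.swap) (rule sum.cartesian_product)
      also have "\<dots> = (\<Sum>(\<beta>, \<delta>) | \<beta> \<noteq> 0 \<and> mi_order (\<beta> + \<delta>) < N. mi_power t (\<beta> + \<delta>) *\<^sub>R G j \<beta> \<delta> (c s))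
          + R j s"
      proof -
        \<comment> \<open>Here N \<le> M enters: every pair of total order below \<open>N\<close>
          has its field within the truncation.\<close>
        have "?B \<times> ?I = {(\<beta>, \<delta>). \<beta> \<noteq> 0 \<and> mi_order (\<beta> + \<delta>) < N} \<union> P"
          using NM by (auto simp: P_def mi_order_add mi_order_pos_iff)
        moreover have "finite {(\<beta>, \<delta> :: nat ^ 'k). \<beta> \<noteq> 0 \<and> mi_order (\<beta> + \<delta>) < N}"
          by (rule finite_subset[OF _ finite_cartesian_product[OF finI finI]]) (auto simp: mi_order_add)
        ultimately show ?thesis unfolding R_def
          by (subst sum.union_disjoint[symmetric]) (auto simp: finP, auto simp: P_def)
      qed
      also have "(\<Sum>(\<beta>, \<delta>) | \<beta> \<noteq> 0 \<and> mi_order (\<beta> + \<delta>) < N. mi_power t (\<beta> + \<delta>) *\<^sub>R G j \<beta> \<delta> (c s))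
          = u (Suc j) s"
      proof -
        have "u (Suc j) s = (\<Sum>\<alpha>\<in>?I. \<Sum>(\<beta>, \<delta>) | \<beta> \<noteq> 0 \<and> \<beta> + \<delta> = \<alpha>. mi_power t (\<beta> + \<delta>) *\<^sub>R G j \<beta> \<delta> (c s))"
          unfolding u_def E_def lie_coeff.simps G_def scaleR_sum_right
          by (intro sum.cong) auto
        also have "\<dots> = (\<Sum>(\<alpha>, \<beta>, \<delta>)\<in>Sigma ?I (\<lambda>\<alpha>. {(\<beta>, \<delta>). \<beta> \<noteq> 0 \<and> \<beta> + \<delta> = \<alpha>}).
            mi_power t (\<beta> + \<delta>) *\<^sub>R G j \<beta> \<delta> (c s))"
          using finI finite_mi_sum by (subst sum.Sigma) auto
        also have "\<dots> = (\<Sum>(\<beta>, \<delta>) | \<beta> \<noteq> 0 \<and> mi_order (\<beta> + \<delta>) < N. mi_power t (\<beta> + \<delta>) *\<^sub>R G j \<beta> \<delta> (c s))"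
          by (rule sum.reindex_bij_witness[of _ "\<lambda>(\<beta>, \<delta>). (\<beta> + \<delta>, \<beta>, \<delta>)" snd]) auto
        finally show ?thesis by simp
      qed
      finally show ?thesis using 1 by simp
    qed
    have R: "norm (R j s) \<le> (\<Sum>(\<beta>, \<delta>)\<in>P. C j \<beta> \<delta>) * norm t ^ N" if "s \<in> {0..1}" for j s
      unfolding R_def sum_distrib_right
    proof (intro sum_norm_le, clarify)
      fix \<beta> \<delta> assume P: "(\<beta>, \<delta>) \<in> P"
      have "norm (mi_power t (\<beta> + \<delta>) *\<^sub>R G j \<beta> \<delta> (c s)) \<le> norm t ^ N * C j \<beta> \<delta>"
        unfolding norm_scaleR
        using P t c[OF that] abs_mi_power_le_power[of t N "\<beta> + \<delta>"] C[of \<beta> "c s" j \<delta>]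
        by (intro mult_mono) (auto simp: P_def mi_order_pos_iff)
      then show "norm (mi_power t (\<beta> + \<delta>) *\<^sub>R G j \<beta> \<delta> (c s)) \<le> C j \<beta> \<delta> * norm t ^ N"
        by (simp add: mult.commute)
    qed
    have u0: "u 0 s = f (c s)" for s
    proof -
      have "u 0 s = (\<Sum>\<alpha>\<in>?I. if \<alpha> = 0 then f (c s) else 0)"
        unfolding u_def E_def by (intro sum.cong) auto
      then show ?thesis using finI NM by simp
    qed
    \<comment> \<open>A monomial of order below \<open>N\<close> cannot arise from \<open>N\<close>
      factors of positive order, so the telescoping sum ends in zero.\<close>
    have uN: "u N s = 0" for s
      unfolding u_def E_def by (intro sum.neutral) (auto simp: lie_coeff_eq_0)
    define a where "a j s = (1 - s) ^ j / fact j" for j and s :: real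
    have a': "(a (Suc j) has_vector_derivative - a j s) (at s within T)" for j s T
      unfolding a_def has_real_derivative_iff_has_vector_derivative[symmetric]
      by (rule derivative_eq_intros refl | simp)+
    define w where "w n s = (\<Sum>j<n. a j s *\<^sub>R u j s)" for n s
    \<comment> \<open>The derivative of \<open>a (Suc n)\<close> is \<open>- a n\<close>, so each
      new term cancels the leftover of the previous sum.\<close>
    have w': "(w (Suc n) has_vector_derivative a n s *\<^sub>R u (Suc n) s + (\<Sum>j<Suc n. a j s *\<^sub>R R j s))
        (at s within {0..1})" if s: "s \<in> {0..1}" for n s
    proof (induction n)
      case 0
      then show ?case using u'[OF s, of 0] by (simp add: w_def a_def)
    next
      case (Suc n)
      have "((\<lambda>s. w (Suc n) s + a (Suc n) s *\<^sub>R u (Suc n) s) has_vector_derivative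
          (a n s *\<^sub>R u (Suc n) s + (\<Sum>j<Suc n. a j s *\<^sub>R R j s)) +
          (a (Suc n) s *\<^sub>R (u (Suc (Suc n)) s + R (Suc n) s) + (- a n s) *\<^sub>R u (Suc n) s))
          (at s within {0..1})"
        by (intro has_vector_derivative_add has_vector_derivative_scaleR Suc u'[OF s] )
          (simp add: has_real_derivative_iff_has_vector_derivative a')
      moreover have "w (Suc (Suc n)) = (\<lambda>s. w (Suc n) s + a (Suc n) s *\<^sub>R u (Suc n) s)"
        by (simp add: w_def fun_eq_iff)
      ultimately show ?case by (simp add: algebra_simps)
    qed
    obtain n where n: "N = Suc n" using NM by (cases N) auto
    have "norm (w N 1 - w N 0) \<le> (\<Sum>j<N. \<Sum>(\<beta>, \<delta>)\<in>P. C j \<beta> \<delta>) * norm t ^ N * 1"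
    proof (rule integral_curve_norm_diff_bound)
      fix s :: real
      show "s \<in> {0..1} \<Longrightarrow> (w N has_vector_derivative (\<Sum>j<N. a j s *\<^sub>R R j s)) (at s within {0..1})"
        using w'[of s n] uN by (simp add: n)
      assume s: "s \<in> {0..<1}"
      show "norm (\<Sum>j<N. a j s *\<^sub>R R j s) \<le> (\<Sum>j<N. \<Sum>(\<beta>, \<delta>)\<in>P. C j \<beta> \<delta>) * norm t ^ N"
        unfolding sum_distrib_right[where A = "{..<N}"]
      proof (rule sum_norm_le)
        fix j
        have "(1 - s) ^ j \<le> fact j"
          using s by (intro order_trans[OF power_le_one fact_ge_1]) auto
        then have "\<bar>a j s\<bar> \<le> 1"
          using s by (simp add: a_def)
        then have "norm (a j s *\<^sub>R R j s) \<le> 1 * norm (R j s)"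
          unfolding norm_scaleR by (intro mult_right_mono) auto
        then show "norm (a j s *\<^sub>R R j s) \<le> (\<Sum>(\<beta>, \<delta>)\<in>P. C j \<beta> \<delta>) * norm t ^ N"
          using R[of s j] s by simp
      qed
    qed simp
    moreover have "w N 1 = f (c 1)"
    proof -
      \<comment> \<open>At time 1 every weight \<open>a j\<close> with j > 0 vanishes.\<close>
      have "w N 1 = (\<Sum>j<N. if j = 0 then f (c 1) else 0)"
        unfolding w_def a_def by (intro sum.cong) (auto simp: u0)
      then show ?thesis using NM by simp
    qed
    moreover have "w N 0 = (\<Sum>\<alpha>\<in>?I. mi_power t \<alpha> *\<^sub>R exp_coeff Z f \<alpha> (c 0))"
    proof -
      have "w N 0 = (\<Sum>\<alpha>\<in>?I. \<Sum>j<N. mi_power t \<alpha> *\<^sub>R (1 / fact j) *\<^sub>R E j \<alpha> (c 0))"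
        unfolding w_def a_def u_def scaleR_sum_right by (subst sum.swap) (simp add: mult.commute)
      also have "\<dots> = (\<Sum>\<alpha>\<in>?I. mi_power t \<alpha> *\<^sub>R exp_coeff Z f \<alpha> (c 0))"
        unfolding E_def scaleR_sum_right[symmetric]
        by (intro sum.cong refl arg_cong[where f = "scaleR _"] exp_coeff_extend) simp
      finally show ?thesis .
    qed
    ultimately show "norm (f (c 1) - (\<Sum>\<alpha>\<in>?I. mi_power t \<alpha> *\<^sub>R exp_coeff Z f \<alpha> (c 0)))
        \<le> (\<Sum>j<N. \<Sum>(\<beta>, \<delta>)\<in>P. C j \<beta> \<delta>) * norm t ^ N"
      by simp
  qed
qed

subsection \<open>Uniqueness of asymptotic expansions\<close>

text \<open>Induction over the set of variables. The indices in \<open>A\<close> are told apart by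
  their exponents in \<open>I\<close>, so with no variable left \<open>A\<close> is a single index.
  Otherwise the sum is a polynomial in the variable \<open>i\<close> with the others frozen; it
  vanishes identically, and each of its coefficients is a sum of the same kind over the indices with
  a given exponent at \<open>i\<close>.\<close>

lemma mi_power_independent_aux:
  fixes a :: "nat ^ 'k::finite \<Rightarrow> real"
  assumes "finite I" "finite A"
    and "\<And>\<alpha> \<beta>. \<alpha> \<in> A \<Longrightarrow> \<beta> \<in> A \<Longrightarrow> (\<And>i. i \<in> I \<Longrightarrow> \<alpha> $ i = \<beta> $ i) \<Longrightarrow> \<alpha> = \<beta>"
    and "\<And>t :: real ^ 'k. (\<Sum>\<alpha>\<in>A. a \<alpha> * (\<Prod>i\<in>I. t $ i ^ (\<alpha> $ i))) = 0"
    and "\<alpha> \<in> A"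
  shows "a \<alpha> = 0"
  using assms
proof (induction I arbitrary: A rule: finite_induct)
  case empty
  then have "A = {\<alpha>}" by blast
  then show ?case using empty.prems(3) by simp
next
  case (insert i I)
  obtain D where D: "\<And>\<beta>. \<beta> \<in> A \<Longrightarrow> \<beta> $ i \<le> D"
    using finite_nat_set_iff_bounded_le[of "(\<lambda>\<beta>. \<beta> $ i) ` A"] insert.prems(1) by auto
  show ?case
  proof (rule insert.IH)
    fix t :: "real ^ 'k"
    define c where "c e = (\<Sum>\<beta> | \<beta> \<in> A \<and> \<beta> $ i = e. a \<beta> * (\<Prod>j\<in>I. t $ j ^ (\<beta> $ j)))" for e
    have "(\<Sum>e\<le>D. c e * y ^ e) = 0" for y
    proof -
      define t' where "t' = (\<chi> j. if j = i then y else t $ j)"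
      have "0 = (\<Sum>\<beta>\<in>A. a \<beta> * (\<Prod>j\<in>insert i I. t' $ j ^ (\<beta> $ j)))"
        using insert.prems(3) by simp
      also have "\<dots> = (\<Sum>\<beta>\<in>A. a \<beta> * (\<Prod>j\<in>I. t $ j ^ (\<beta> $ j)) * y ^ (\<beta> $ i))"
      proof (rule sum.cong[OF refl])
        fix \<beta>
        have "(\<Prod>j\<in>I. t' $ j ^ (\<beta> $ j)) = (\<Prod>j\<in>I. t $ j ^ (\<beta> $ j))"
          using insert.hyps(2) by (intro prod.cong) (auto simp: t'_def)
        then show "a \<beta> * (\<Prod>j\<in>insert i I. t' $ j ^ (\<beta> $ j))
            = a \<beta> * (\<Prod>j\<in>I. t $ j ^ (\<beta> $ j)) * y ^ (\<beta> $ i)"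
          using insert.hyps by (simp add: t'_def mult_ac)
      qed
      also have "\<dots> = (\<Sum>e\<le>D. \<Sum>\<beta> | \<beta> \<in> A \<and> \<beta> $ i = e.
          a \<beta> * (\<Prod>j\<in>I. t $ j ^ (\<beta> $ j)) * y ^ (\<beta> $ i))"
        using D by (subst sum.group[OF insert.prems(1)]) auto
      also have "\<dots> = (\<Sum>e\<le>D. c e * y ^ e)"
        unfolding c_def sum_distrib_right by (intro sum.cong) auto
      finally show ?thesis by simp
    qed
    then have "c (\<alpha> $ i) = 0"
      using polyfun_eq_0[of c D] D[OF insert.prems(4)] by blast
    then show "(\<Sum>\<beta>\<in>{\<beta> \<in> A. \<beta> $ i = \<alpha> $ i}. a \<beta> * (\<Prod>j\<in>I. t $ j ^ (\<beta> $ j))) = 0"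
      by (simp add: c_def)
  next
    fix \<beta> \<beta>'
    assume "\<beta> \<in> {\<beta> \<in> A. \<beta> $ i = \<alpha> $ i}" "\<beta>' \<in> {\<beta> \<in> A. \<beta> $ i = \<alpha> $ i}"
      "\<And>j. j \<in> I \<Longrightarrow> \<beta> $ j = \<beta>' $ j"
    then show "\<beta> = \<beta>'" by (intro insert.prems(2)) auto
  qed (use insert.prems in auto)
qed

lemma mi_power_independent:
  fixes a :: "nat ^ 'k::finite \<Rightarrow> 'b::euclidean_space"
  assumes "finite A" "\<And>t :: real ^ 'k. (\<Sum>\<alpha>\<in>A. mi_power t \<alpha> *\<^sub>R a \<alpha>) = 0" "\<alpha> \<in> A"
  shows "a \<alpha> = 0"
proof (rule euclidean_eqI)
  fix b :: 'b
  have "(\<Sum>\<alpha>\<in>A. (a \<alpha> \<bullet> b) * (\<Prod>i\<in>UNIV. t $ i ^ (\<alpha> $ i))) = 0" for t :: "real ^ 'k"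
    using arg_cong[OF assms(2)[of t], of "\<lambda>v. v \<bullet> b"]
    by (simp add: inner_sum_left mi_power_def mult.commute)
  then show "a \<alpha> \<bullet> b = 0 \<bullet> b"
    using mi_power_independent_aux[of UNIV A "\<lambda>\<alpha>. a \<alpha> \<bullet> b" \<alpha>] assms by (simp add: vec_eq_iff)
qed

text \<open>Once the lower coefficients are zero, the sum below order \<open>Suc ?m\<close> is a
  homogeneous polynomial of degree \<open>?m\<close> that is bounded by a power one higher.
  Shrinking along a ray forces it to vanish, and independence of the monomials gives the
  coefficient.\<close>

lemma asymptotic_expansion_unique:
  fixes a :: "nat ^ 'k::finite \<Rightarrow> 'b::euclidean_space"
  assumes "\<And>N. N \<ge> 1 \<Longrightarrow> \<exists>C \<delta>. 0 < \<delta> \<and> (\<forall>t. norm t < \<delta> \<longrightarrow>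
      norm (\<Sum>\<alpha> | mi_order \<alpha> < N. mi_power t \<alpha> *\<^sub>R a \<alpha>) \<le> C * norm t ^ N)"
  shows "a \<alpha> = 0"
proof (induction "mi_order \<alpha>" arbitrary: \<alpha> rule: less_induct)
  case less
  let ?m = "mi_order \<alpha>"
  let ?A = "{\<beta> :: nat ^ 'k. mi_order \<beta> = ?m}"
  define P where "P t = (\<Sum>\<beta>\<in>?A. mi_power t \<beta> *\<^sub>R a \<beta>)" for t
  have finA: "finite ?A" by (rule finite_subset[OF _ finite_mi_order_le[of ?m]]) auto
  have "(\<Sum>\<beta> | mi_order \<beta> < Suc ?m. mi_power t \<beta> *\<^sub>R a \<beta>) = P t" for t
    unfolding P_def using less finite_mi_order_less[of "Suc ?m"]
    by (intro sum.mono_neutral_right) (auto simp: less_Suc_eq)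
  then obtain C \<delta> where \<delta>: "0 < \<delta>" and C: "\<And>t. norm t < \<delta> \<Longrightarrow> norm (P t) \<le> C * norm t ^ Suc ?m"
    using assms[of "Suc ?m"] by auto
  have "P t = 0" for t
  proof (rule ccontr)
    assume "P t \<noteq> 0"
    define D where "D = \<bar>C\<bar> * norm t ^ Suc ?m + 1"
    have D: "D > 0" unfolding D_def by (smt (verit) abs_ge_zero mult_nonneg_nonneg norm_ge_zero zero_le_power)
    \<comment> \<open>The first bound keeps \<open>r *\<^sub>R t\<close> within radius \<delta>; the
      second gives \<open>r * D \<le> norm (P t)\<close>, against the estimate
      \<open>norm (P t) < r * D\<close>.\<close>
    define r where "r = min (\<delta> / (norm t + 1)) (norm (P t) / D)"
    have r: "r > 0" using \<delta> D \<open>P t \<noteq> 0\<close> by (simp add: r_def add_nonneg_pos)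
    have "r * norm t < \<delta>"
    proof -
      have "r * (norm t + 1) \<le> \<delta>"
        using norm_ge_zero[of t] unfolding r_def
        by (smt (verit) pos_le_divide_eq)
      then show ?thesis using r by (simp add: algebra_simps)
    qed
    then have "norm (P (r *\<^sub>R t)) \<le> C * norm (r *\<^sub>R t) ^ Suc ?m"
      using r by (intro C) simp
    moreover have "P (r *\<^sub>R t) = r ^ ?m *\<^sub>R P t"
      unfolding P_def scaleR_sum_right by (intro sum.cong) (auto simp: mi_power_scaleR)
    ultimately have "r ^ ?m * norm (P t) \<le> r ^ ?m * (r * (C * norm t ^ Suc ?m))"
      using r by (simp add: power_mult_distrib mult_ac)
    then have "norm (P t) \<le> r * (C * norm t ^ Suc ?m)" using r by simp
    also have "\<dots> < r * D"
    proof (rule mult_strict_left_mono[OF _ r])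
      have "C * norm t ^ Suc ?m \<le> \<bar>C\<bar> * norm t ^ Suc ?m" by (intro mult_right_mono) auto
      then show "C * norm t ^ Suc ?m < D" by (simp add: D_def)
    qed
    also have "\<dots> \<le> norm (P t)" using D by (simp add: r_def min_def pos_le_divide_eq)
    finally show False by simp
  qed
  then show ?case
    using mi_power_independent[OF finA, of a \<alpha>] by (simp add: P_def)
qed

subsection \<open>Expansion of the exponential and of a smooth family\<close>

lemma mi_fact_nonzero: "mi_fact \<alpha> \<noteq> 0"
  by (simp add: mi_fact_def)

text \<open>The mean value inequality asks for convexity, which a union of balls may lack. So one
  constant is taken from the compact \<open>K\<close>, and the inequality is stated on convex pieces
  of it.\<close>

lemma smooth_on_lipschitz_bound:
  fixes f :: "'a::euclidean_space \<Rightarrow> 'b::euclidean_space"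
  assumes "smooth_on S f" "compact K" "K \<subseteq> S"
  obtains L where "L \<ge> 0" "\<And>D y z. convex D \<Longrightarrow> D \<subseteq> K \<Longrightarrow> y \<in> D \<Longrightarrow> z \<in> D \<Longrightarrow>
    norm (f y - f z) \<le> L * norm (y - z)"
proof -
  obtain L where L: "L \<ge> 0" "\<And>x v. x \<in> K \<Longrightarrow> norm (frechet_derivative f (at x) v) \<le> L * norm v"
    using smooth_on_derivative_bound[OF assms] by blast
  show ?thesis
  proof (rule that[OF L(1)])
    fix D y z assume D: "convex D" "D \<subseteq> K" "y \<in> D" "z \<in> D"
    show "norm (f y - f z) \<le> L * norm (y - z)"
    proof (rule differentiable_bound[OF D(1) _ _ D(3,4)])
      fix x assume "x \<in> D"
      then have "x \<in> S" using D(2) assms(3) by blast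
      then show "(f has_derivative frechet_derivative f (at x)) (at x within D)"
        by (rule has_derivative_at_withinI[OF smooth_on_frechet(1)[OF assms(1)]])
      show "onorm (frechet_derivative f (at x)) \<le> L"
        using L \<open>x \<in> D\<close> D(2) by (intro onorm_bound) auto
    qed
  qed
qed

text \<open>Every term of the truncated field carries a positive power of \<open>t\<close>, so on a
  compact thickening of \<open>K\<close> its size and Lipschitz constant are O(|t|). For small
  \<open>t\<close> all balls of one radius around points of \<open>K\<close> meet the conditions of
  \<open>exp_vf_eq\<close>, and the curves stay in the thickening, where one error constant
  serves.\<close>

lemma exp_vf_expansion:
  fixes Y :: "nat ^ 'k::finite \<Rightarrow> 'a::euclidean_space \<Rightarrow> 'a"
  assumes S: "open S" and sm: "\<And>\<alpha>. \<alpha> \<noteq> 0 \<Longrightarrow> smooth_on S (Y \<alpha>)"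
    and K: "compact K" "K \<subseteq> S" and N: "1 \<le> N"
  shows "\<exists>C \<delta>. 0 < \<delta> \<and> (\<forall>x\<in>K. \<forall>t. norm t < \<delta> \<longrightarrow>
    exp_vf_defined S (truncated_field Y N t) x \<and> norm (exp_vf S (truncated_field Y N t) x -
       (\<Sum>\<alpha> | mi_order \<alpha> < N. mi_power t \<alpha> *\<^sub>R
          exp_coeff (\<lambda>\<alpha> x. (1 / mi_fact \<alpha>) *\<^sub>R Y \<alpha> x) (\<lambda>x. x) \<alpha> x)) \<le> C * norm t ^ N)"
proof -
  define Z where "Z \<alpha> x = (1 / mi_fact \<alpha>) *\<^sub>R Y \<alpha> x" for \<alpha> x
  let ?I = "{\<alpha> :: nat ^ 'k. 0 < mi_order \<alpha> \<and> mi_order \<alpha> < N}"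
  have smZ: "smooth_on S (Z \<alpha>)" if "\<alpha> \<noteq> 0" for \<alpha>
    unfolding Z_def by (rule smooth_on_scaleR_const[OF S sm[OF that]])
  have tf: "truncated_field Y N t = (\<lambda>x. \<Sum>\<alpha>\<in>?I. mi_power t \<alpha> *\<^sub>R Z \<alpha> x)" for t
    by (simp add: truncated_field_def Z_def fun_eq_iff)
  obtain r where r: "r > 0" "(\<Union>x\<in>K. cball x r) \<subseteq> S"
    using compact_subset_open_imp_cball_epsilon_subset[OF K(1) S K(2)] by blast
  define K' where "K' = (\<Union>x\<in>K. cball x r)"
  \<comment> \<open>Written as a Minkowski sum of compact sets, the thickening is seen to be
    compact.\<close>
  have "K' = {x + y |x y. x \<in> K \<and> y \<in> cball 0 r}"
  proof (intro set_eqI iffI)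
    fix z assume "z \<in> K'"
    then obtain x where "x \<in> K" "dist x z \<le> r" by (auto simp: K'_def)
    then show "z \<in> {x + y |x y. x \<in> K \<and> y \<in> cball 0 r}"
      by (intro CollectI exI[of _ x] exI[of _ "z - x"]) (auto simp: dist_norm norm_minus_commute)
  next
    fix z assume "z \<in> {x + y |x y. x \<in> K \<and> y \<in> cball 0 r}"
    then obtain x y where "z = x + y" "x \<in> K" "norm y \<le> r" by auto
    then show "z \<in> K'" unfolding K'_def by (intro UN_I[of x]) (auto simp: dist_norm)
  qed
  then have K': "compact K'" "K' \<subseteq> S"
    using compact_sums[OF K(1) compact_cball[of 0 r]] r(2) by (simp_all add: K'_def)
  define Q where "Q \<alpha> L B \<longleftrightarrow> L \<ge> 0 \<and> B \<ge> 0 \<and> (\<forall>x\<in>K'. norm (Z \<alpha> x) \<le> B) \<and>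
      (\<forall>x\<in>K. \<forall>y\<in>cball x r. \<forall>z\<in>cball x r. norm (Z \<alpha> y - Z \<alpha> z) \<le> L * norm (y - z))"
    for \<alpha> L B
  have "\<exists>L B. Q \<alpha> L B" if "\<alpha> \<in> ?I" for \<alpha>
  proof -
    have \<alpha>: "\<alpha> \<noteq> 0" using that mi_order_pos_iff by blast
    obtain L where L: "L \<ge> 0" "\<And>D y z. convex D \<Longrightarrow> D \<subseteq> K' \<Longrightarrow> y \<in> D \<Longrightarrow> z \<in> D \<Longrightarrow>
        norm (Z \<alpha> y - Z \<alpha> z) \<le> L * norm (y - z)"
      using smooth_on_lipschitz_bound[OF smZ[OF \<alpha>] K'] by blast
    have "bounded (Z \<alpha> ` K')"
      by (intro compact_imp_bounded compact_continuous_image K'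
          continuous_on_subset[OF smooth_on_imp_continuous_on[OF smZ[OF \<alpha>]]])
    then obtain B where B: "B > 0" "\<forall>x\<in>K'. norm (Z \<alpha> x) \<le> B" by (auto simp: bounded_pos)
    have "\<forall>x\<in>K. \<forall>y\<in>cball x r. \<forall>z\<in>cball x r. norm (Z \<alpha> y - Z \<alpha> z) \<le> L * norm (y - z)"
      by (intro ballI L(2)[OF convex_cball]) (auto simp: K'_def)
    with L(1) B show ?thesis unfolding Q_def by (intro exI[of _ L] exI[of _ B]) simp
  qed
  then obtain L B where "\<And>\<alpha>. \<alpha> \<in> ?I \<Longrightarrow> Q \<alpha> (L \<alpha>) (B \<alpha>)" by metis
  then have LB: "\<alpha> \<in> ?I \<Longrightarrow> L \<alpha> \<ge> 0" "\<alpha> \<in> ?I \<Longrightarrow> B \<alpha> \<ge> 0"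
    "\<And>x. \<alpha> \<in> ?I \<Longrightarrow> x \<in> K' \<Longrightarrow> norm (Z \<alpha> x) \<le> B \<alpha>"
    "\<And>x y z. \<alpha> \<in> ?I \<Longrightarrow> x \<in> K \<Longrightarrow> y \<in> cball x r \<Longrightarrow> z \<in> cball x r \<Longrightarrow>
       norm (Z \<alpha> y - Z \<alpha> z) \<le> L \<alpha> * norm (y - z)" for \<alpha>
    unfolding Q_def by blast+
  define LL where "LL = (\<Sum>\<alpha>\<in>?I. L \<alpha>)"
  define BB where "BB = (\<Sum>\<alpha>\<in>?I. B \<alpha>)"
  have nn: "LL \<ge> 0" "BB \<ge> 0" unfolding LL_def BB_def using LB by (auto intro: sum_nonneg)
  obtain C where C: "\<forall>c t. norm t \<le> 1 \<longrightarrow>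
      (\<forall>s\<in>{0..1}. c s \<in> K' \<and> (c has_vector_derivative
         (\<Sum>\<beta>\<in>?I. mi_power t \<beta> *\<^sub>R Z \<beta> (c s))) (at s within {0..1})) \<longrightarrow>
      norm (c 1 - (\<Sum>\<alpha> | mi_order \<alpha> < N. mi_power t \<alpha> *\<^sub>R exp_coeff Z (\<lambda>x. x) \<alpha> (c 0))) \<le> C * norm t ^ N"
    using exp_coeff_expansion[OF S smooth_on_id[OF S] smZ K' N order_refl] ..
  \<comment> \<open>The quotients ensure \<open>norm t * BB \<le> r / 2\<close> and
    \<open>norm t * LL \<le> 1 / 2\<close>, as \<open>exp_vf_eq\<close> requires; the bound 1 makes
    every positive power of \<open>norm t\<close> at most \<open>norm t\<close>. Adding 1 keeps the
    denominators positive.\<close>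
  define \<delta> where "\<delta> = min 1 (min (r / (2 * (BB + 1))) (1 / (2 * (LL + 1))))"
  have "\<delta> > 0" using r nn by (simp add: \<delta>_def)
  have key: "exp_vf_defined S (truncated_field Y N t) x \<and> norm (exp_vf S (truncated_field Y N t) x -
       (\<Sum>\<alpha> | mi_order \<alpha> < N. mi_power t \<alpha> *\<^sub>R exp_coeff Z (\<lambda>x. x) \<alpha> x)) \<le> C * norm t ^ N"
    if x: "x \<in> K" and t: "norm t < \<delta>" for x t
  proof -
    have t1: "norm t \<le> 1" and tB: "norm t * (2 * (BB + 1)) \<le> r" and tL: "norm t * (2 * (LL + 1)) \<le> 1"
      using t nn by (auto simp: \<delta>_def pos_le_divide_eq[symmetric] intro: less_imp_le)
    have p: "\<bar>mi_power t \<alpha>\<bar> \<le> norm t" if "\<alpha> \<in> ?I" for \<alpha>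
      using abs_mi_power_le_power[OF t1, of 1 \<alpha>] that by simp
    have xK': "cball x r \<subseteq> K'" using x by (auto simp: K'_def)
    have bnd: "norm (truncated_field Y N t y) \<le> r / 2" if "y \<in> cball x r" for y
    proof -
      have "norm (truncated_field Y N t y) \<le> (\<Sum>\<alpha>\<in>?I. norm t * B \<alpha>)"
        unfolding tf using p LB that xK' by (intro sum_norm_le) (auto intro!: mult_mono)
      also have "\<dots> = norm t * BB" by (simp add: BB_def sum_distrib_left)
      also have "\<dots> \<le> r / 2" using tB by (simp add: algebra_simps) (smt (verit) norm_ge_zero)
      finally show ?thesis .
    qed
    have lip: "norm (truncated_field Y N t y - truncated_field Y N t z) \<le> norm (y - z) / 2"
      if "y \<in> cball x r" "z \<in> cball x r" for y z
    proof -
      have "norm (truncated_field Y N t y - truncated_field Y N t z)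
          = norm (\<Sum>\<alpha>\<in>?I. mi_power t \<alpha> *\<^sub>R (Z \<alpha> y - Z \<alpha> z))"
        unfolding tf by (simp add: scaleR_diff_right sum_subtractf)
      also have "\<dots> \<le> (\<Sum>\<alpha>\<in>?I. norm t * (L \<alpha> * norm (y - z)))"
      proof (rule sum_norm_le)
        fix \<alpha> assume "\<alpha> \<in> ?I"
        then show "norm (mi_power t \<alpha> *\<^sub>R (Z \<alpha> y - Z \<alpha> z)) \<le> norm t * (L \<alpha> * norm (y - z))"
          unfolding norm_scaleR using LB(4)[OF _ x that] p by (intro mult_mono) auto
      qed
      also have "\<dots> = (norm t * LL) * norm (y - z)"
        by (simp add: LL_def sum_distrib_left sum_distrib_right mult.assoc)
      also have "\<dots> \<le> (1 / 2) * norm (y - z)"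
        using tL by (intro mult_right_mono) (simp_all add: algebra_simps, smt (verit) norm_ge_zero)
      finally show ?thesis by simp
    qed
    have xS: "cball x r \<subseteq> S" using xK' K' by blast
    obtain c where c: "exp_vf_defined S (truncated_field Y N t) x" "exp_vf S (truncated_field Y N t) x = c (1::real)"
      "c 0 = x" "\<And>s. s \<in> {0..1} \<Longrightarrow> c s \<in> cball x r"
      "\<And>s. s \<in> {0..1} \<Longrightarrow> (c has_vector_derivative truncated_field Y N t (c s)) (at s within {0..1})"
      using exp_vf_eq[OF r(1) bnd lip xS] by blast
    have "norm (c 1 - (\<Sum>\<alpha> | mi_order \<alpha> < N. mi_power t \<alpha> *\<^sub>R exp_coeff Z (\<lambda>x. x) \<alpha> (c 0))) \<le> C * norm t ^ N"
      using c(4,5) xK' by (intro C[rule_format, OF t1]) (auto simp: tf)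
    then show ?thesis using c(1-3) by simp
  qed
  show ?thesis unfolding Z_def[symmetric] using key \<open>\<delta> > 0\<close> by blast
qed

section \<open>Taylor expansion of the family in the parameter\<close>

text \<open>The terms \<open>t_i \<partial>_i\<close> of the constant vector field \<open>(0, t)\<close>.\<close>

definition parameter_field :: "nat ^ 'k::finite \<Rightarrow> 'a::euclidean_space \<times> (real ^ 'k) \<Rightarrow> 'a \<times> (real ^ 'k)" where
  "parameter_field \<beta> p = (0, \<chi> i. if \<beta> = axis i 1 then 1 else 0)"

lemma smooth_on_parameter_field: "open W \<Longrightarrow> smooth_on W (parameter_field \<beta>)"
  unfolding parameter_field_def[abs_def] by (rule smooth_on_const)

text \<open>From M \<ge> 2 on, all first-order indices lie in the range of summation, and only they
  contribute.\<close>

lemma sum_parameter_field: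
  fixes t :: "real ^ 'k::finite"
  assumes "M \<ge> 2"
  shows "(\<Sum>\<beta> | 0 < mi_order \<beta> \<and> mi_order \<beta> < M. mi_power t \<beta> *\<^sub>R parameter_field \<beta> p) = (0, t)"
proof -
  let ?I = "{\<beta> :: nat ^ 'k. 0 < mi_order \<beta> \<and> mi_order \<beta> < M}"
  have "mi_order (axis i 1 :: nat ^ 'k) = 1" for i
    by (simp add: mi_order_def axis_def)
  then have "axis i 1 \<in> ?I" for i using assms by simp
  then have "(\<Sum>\<beta>\<in>?I. mi_power t \<beta> * (if \<beta> = axis i 1 then 1 else 0)) = t $ i" for i
    using finite_mi_order_between[of M, where 'k = 'k]
    by (simp add: mi_power_axis[unfolded One_nat_def] if_distrib cong: if_cong)
  then show ?thesis
    by (simp add: prod_eq_iff fst_sum snd_sum parameter_field_def vec_eq_iff)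
qed

text \<open>The segment from \<open>(x, 0)\<close> to \<open>(x, t)\<close> is an integral curve of
  the constant field, and the coefficients are the partial derivatives of \<gamma> in
  \<open>t\<close> at \<open>(x, 0)\<close>, divided by the factorial of \<alpha>.\<close>

lemma taylor_expansion_parameter:
  fixes \<gamma> :: "'a::euclidean_space \<times> (real ^ 'k::finite) \<Rightarrow> 'b::euclidean_space"
  assumes W: "open W" and sm: "smooth_on W \<gamma>"
    and K: "compact K" "\<And>x. x \<in> K \<Longrightarrow> (x, 0) \<in> W" and N: "1 \<le> N"
  shows "\<exists>C \<delta>. 0 < \<delta> \<and> (\<forall>x\<in>K. \<forall>t. norm t < \<delta> \<longrightarrow>
    norm (\<gamma> (x, t) - (\<Sum>\<alpha> | mi_order \<alpha> < N. mi_power t \<alpha> *\<^sub>R exp_coeff parameter_field \<gamma> \<alpha> (x, 0)))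
      \<le> C * norm t ^ N)"
proof -
  have "compact (K \<times> {0 :: real ^ 'k})" "K \<times> {0} \<subseteq> W" using K by (auto intro: compact_Times)
  then obtain r where r: "r > 0" "(\<Union>p\<in>K \<times> {0}. cball p r) \<subseteq> W"
    using compact_subset_open_imp_cball_epsilon_subset[OF _ W] by blast
  have K': "compact (K \<times> cball (0 :: real ^ 'k) r)" "K \<times> cball 0 r \<subseteq> W"
  proof -
    show "compact (K \<times> cball (0 :: real ^ 'k) r)" using K by (intro compact_Times compact_cball)
    show "K \<times> cball 0 r \<subseteq> W"
    proof clarify
      fix x t assume "x \<in> K" "t \<in> cball (0 :: real ^ 'k) r"
      then have "(x, t) \<in> (\<Union>p\<in>K \<times> {0}. cball p r)" by (intro UN_I[of "(x, 0)"]) (auto simp: dist_Pair_Pair)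
      then show "(x, t) \<in> W" using r(2) by blast
    qed
  qed
  obtain C where C: "\<forall>c t. norm t \<le> 1 \<longrightarrow>
      (\<forall>s\<in>{0..1}. c s \<in> K \<times> cball 0 r \<and> (c has_vector_derivative
         (\<Sum>\<beta> | 0 < mi_order \<beta> \<and> mi_order \<beta> < Suc N. mi_power t \<beta> *\<^sub>R parameter_field \<beta> (c s)))
         (at s within {0..1})) \<longrightarrow>
      norm (\<gamma> (c 1) - (\<Sum>\<alpha> | mi_order \<alpha> < N. mi_power t \<alpha> *\<^sub>R exp_coeff parameter_field \<gamma> \<alpha> (c 0)))
        \<le> C * norm t ^ N"
    \<comment> \<open>The cutoff \<open>Suc N\<close> keeps the first-order terms in the field also
      for N = 1.\<close>
    using exp_coeff_expansion[where Z = parameter_field and M = "Suc N",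
        OF W sm smooth_on_parameter_field[OF W] K' N le_SucI[OF order_refl]] ..
  show ?thesis
  proof (intro exI conjI ballI allI impI)
    show "0 < min 1 r" using r by simp
    fix x and t :: "real ^ 'k" assume x: "x \<in> K" and t: "norm t < min 1 r"
    have "norm (s *\<^sub>R t) \<le> r" if "s \<in> {0..1}" for s
      using mult_mono[of "\<bar>s\<bar>" 1 "norm t" r] t that by simp
    moreover have "((\<lambda>s. (x, s *\<^sub>R t)) has_vector_derivative (0, t)) (at s within {0..1})" for s :: real
      by (auto intro!: derivative_eq_intros)
    ultimately have "norm (\<gamma> (x, 1 *\<^sub>R t) -
        (\<Sum>\<alpha> | mi_order \<alpha> < N. mi_power t \<alpha> *\<^sub>R exp_coeff parameter_field \<gamma> \<alpha> (x, 0 *\<^sub>R t))) \<le> C * norm t ^ N"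
      using N t x by (intro C[rule_format, of _ "\<lambda>s. (x, s *\<^sub>R t)"]) (auto simp: sum_parameter_field)
    then show "norm (\<gamma> (x, t) - (\<Sum>\<alpha> | mi_order \<alpha> < N. mi_power t \<alpha> *\<^sub>R exp_coeff parameter_field \<gamma> \<alpha> (x, 0)))
        \<le> C * norm t ^ N"
      by simp
  qed
qed

subsection \<open>Solving the triangular system\<close>

text \<open>Iterates the map that solves each equation with the previous family in the nonlinear
  terms. Since \<open>lie_coeff\<close> takes a whole family as argument, the recursion runs over
  stages: at stage \<open>m\<close> the entries of positive order at most \<open>m\<close> are
  final, those of higher order provisional.\<close>

primrec field_stage ::
  "(nat ^ 'k::finite \<Rightarrow> 'a::euclidean_space \<Rightarrow> 'a) \<Rightarrow> nat \<Rightarrow> nat ^ 'k \<Rightarrow> 'a \<Rightarrow> 'a" where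
  "field_stage g 0 = (\<lambda>\<alpha> x. 0)"
| "field_stage g (Suc m) = (\<lambda>\<alpha> x. g \<alpha> x -
     (\<Sum>j = 2..mi_order \<alpha>. (1 / fact j) *\<^sub>R lie_coeff (field_stage g m) (\<lambda>x. x) j \<alpha> x))"

lemma smooth_on_field_stage:
  assumes "open S" "\<And>\<alpha>. \<alpha> \<noteq> 0 \<Longrightarrow> smooth_on S (g \<alpha>)" "\<alpha> \<noteq> 0"
  shows "smooth_on S (field_stage g m \<alpha>)"
  using assms(3)
proof (induction m arbitrary: \<alpha>)
  case (Suc m)
  then show ?case unfolding field_stage.simps
    by (intro smooth_on_diff smooth_on_sum smooth_on_scaleR_const smooth_on_lie_coeff smooth_on_id assms)
qed (simp add: smooth_on_const[OF assms(1)])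

text \<open>An entry at stage \<open>Suc m\<close> reads only entries of lower order at stage
  \<open>m\<close>, and these are final by induction.\<close>

lemma field_stage_stable:
  "0 < mi_order \<alpha> \<Longrightarrow> mi_order \<alpha> \<le> m \<Longrightarrow> mi_order \<alpha> \<le> n \<Longrightarrow> field_stage g m \<alpha> x = field_stage g n \<alpha> x"
proof (induction m arbitrary: n \<alpha> x)
  case (Suc m)
  obtain n' where n: "n = Suc n'" using Suc.prems by (cases n) auto
  have "lie_coeff (field_stage g m) (\<lambda>x. x) j \<alpha> x = lie_coeff (field_stage g n') (\<lambda>x. x) j \<alpha> x"
    if "j \<ge> 2" for j
    using Suc.prems that by (intro lie_coeff_local_2[OF open_UNIV] Suc.IH) (auto simp: n)
  then show ?case unfolding n by simp
qed simp

text \<open>Each index is read off at the stage equal to its order. Locality is applied on the whole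
  space, so the equations hold at every point, while smoothness is obtained on
  \<open>S\<close>.\<close>

lemma exp_coeff_id_surj:
  fixes g :: "nat ^ 'k::finite \<Rightarrow> 'a::euclidean_space \<Rightarrow> 'a"
  assumes "open S" "\<And>\<alpha>. \<alpha> \<noteq> 0 \<Longrightarrow> smooth_on S (g \<alpha>)"
  obtains Z where "\<And>\<alpha>. \<alpha> \<noteq> 0 \<Longrightarrow> smooth_on S (Z \<alpha>)"
    "\<And>\<alpha> x. \<alpha> \<noteq> 0 \<Longrightarrow> exp_coeff Z (\<lambda>x. x) \<alpha> x = g \<alpha> x"
proof
  define Z where "Z \<alpha> = field_stage g (mi_order \<alpha>) \<alpha>" for \<alpha>
  fix \<alpha> :: "nat ^ 'k" assume \<alpha>: "\<alpha> \<noteq> 0"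
  show "smooth_on S (Z \<alpha>)" unfolding Z_def by (rule smooth_on_field_stage[OF assms \<alpha>])
  fix x
  obtain m where m: "mi_order \<alpha> = Suc m" using \<alpha> mi_order_pos_iff[of \<alpha>] gr0_implies_Suc by blast
  \<comment> \<open>Below the order of \<alpha> this diagonal family agrees with stage
    \<open>m\<close>.\<close>
  have "lie_coeff Z (\<lambda>x. x) j \<alpha> x = lie_coeff (field_stage g m) (\<lambda>x. x) j \<alpha> x" if "j \<ge> 2" for j
    using that m by (intro lie_coeff_local_2[OF open_UNIV]) (auto simp: Z_def intro: field_stage_stable)
  then have "Z \<alpha> x = g \<alpha> x - (\<Sum>j = 2..mi_order \<alpha>. (1 / fact j) *\<^sub>R lie_coeff Z (\<lambda>x. x) j \<alpha> x)"
    unfolding Z_def[of \<alpha>] m field_stage.simps by simp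
  then show "exp_coeff Z (\<lambda>x. x) \<alpha> x = g \<alpha> x" unfolding exp_coeff_id[OF \<alpha>] by simp
qed

text \<open>Once the fields of lower order agree on the open \<open>T\<close>, the nonlinear terms
  agree there and cancel from the two equations.\<close>

lemma exp_coeff_id_inj:
  assumes "open T" and eq: "\<And>\<alpha> x. \<alpha> \<noteq> 0 \<Longrightarrow> x \<in> T \<Longrightarrow> exp_coeff Z (\<lambda>x. x) \<alpha> x = exp_coeff Z' (\<lambda>x. x) \<alpha> x"
  shows "\<alpha> \<noteq> 0 \<Longrightarrow> x \<in> T \<Longrightarrow> Z \<alpha> x = Z' \<alpha> x"
proof (induction "mi_order \<alpha>" arbitrary: \<alpha> x rule: less_induct)
  case less
  have "lie_coeff Z (\<lambda>x. x) j \<alpha> x = lie_coeff Z' (\<lambda>x. x) j \<alpha> x" if "j \<ge> 2" for j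
    using that less.prems by (intro lie_coeff_local_2[OF assms(1)] less.hyps) (auto simp: mi_order_pos_iff)
  then show ?case
    using eq[OF less.prems] unfolding exp_coeff_id[OF less.prems(1)] by simp
qed

section \<open>Existence and uniqueness of the fields for the given family\<close>

theorem theorem8p5:
  fixes \<gamma> :: "(real ^ 'n) \<times> (real ^ 'k) \<Rightarrow> real ^ 'n"
    and W :: "((real ^ 'n) \<times> (real ^ 'k)) set"
    and x0 :: "real ^ 'n"
  assumes "open W" and "(x0, 0) \<in> W"
    and "smooth_on W \<gamma>"
    and "\<And>x. (x, 0) \<in> W \<Longrightarrow> \<gamma> (x, 0) = x"
  shows "\<exists>(U :: (real ^ 'n) set) (X :: nat ^ 'k \<Rightarrow> real ^ 'n \<Rightarrow> real ^ 'n).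
      open U \<and> x0 \<in> U \<and> (\<forall>x\<in>U. (x, 0) \<in> W) \<and>
      (\<forall>\<alpha>. \<alpha> \<noteq> 0 \<longrightarrow> smooth_on U (X \<alpha>)) \<and>
      (\<forall>N\<ge>1. \<forall>K. compact K \<and> K \<subseteq> U \<longrightarrow> exp_expansion \<gamma> U X N K) \<and>
      (\<forall>(V :: (real ^ 'n) set) (Y :: nat ^ 'k \<Rightarrow> real ^ 'n \<Rightarrow> real ^ 'n).
          open V \<and> x0 \<in> V \<and> (\<forall>x\<in>V. (x, 0) \<in> W) \<and>
          (\<forall>\<alpha>. \<alpha> \<noteq> 0 \<longrightarrow> smooth_on V (Y \<alpha>)) \<and>
          (\<forall>N\<ge>1. \<forall>x\<in>V. exp_expansion \<gamma> V Y N {x})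
          \<longrightarrow> (\<forall>\<alpha>. \<alpha> \<noteq> 0 \<longrightarrow> (\<forall>x\<in>U \<inter> V. Y \<alpha> x = X \<alpha> x)))"
proof -
  define e where "e x = (x, 0 :: real ^ 'k)" for x :: "real ^ 'n"
  \<comment> \<open>One set for all orders: each \<open>g \<alpha>\<close> is smooth on the whole
    slice, and solving for the fields keeps the domain.\<close>
  define U where "U = e -` W"
  define g where "g \<alpha> x = exp_coeff parameter_field \<gamma> \<alpha> (e x)" for \<alpha> :: "nat ^ 'k" and x
  have e: "bounded_linear e"
    unfolding e_def by (intro bounded_linear_Pair bounded_linear_ident bounded_linear_zero)
  then have U: "open U"
    unfolding U_def using assms(1) by (intro open_vimage linear_continuous_on)
  have smg: "smooth_on U (g \<alpha>)" for \<alpha>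
    unfolding U_def g_def
    by (intro smooth_on_compose_linear[OF assms(1) e] smooth_on_exp_coeff[OF assms(1,3)]
        smooth_on_parameter_field assms(1))
  have g0: "g 0 x = x" if "x \<in> U" for x
    using assms(4)[of x] that by (simp add: g_def exp_coeff_0 U_def e_def)
  obtain Z where smZ: "\<And>\<alpha>. \<alpha> \<noteq> 0 \<Longrightarrow> smooth_on U (Z \<alpha>)"
    and Z: "\<And>\<alpha> x. \<alpha> \<noteq> 0 \<Longrightarrow> exp_coeff Z (\<lambda>x. x) \<alpha> x = g \<alpha> x"
    by (rule exp_coeff_id_surj[OF U, of g]) (use smg in auto)
  define X where "X \<alpha> x = mi_fact \<alpha> *\<^sub>R Z \<alpha> x" for \<alpha> :: "nat ^ 'k" and x
  have XZ: "(\<lambda>\<alpha> x. (1 / mi_fact \<alpha>) *\<^sub>R X \<alpha> x) = Z"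
    by (simp add: X_def fun_eq_iff mi_fact_nonzero)
  have smX: "smooth_on U (X \<alpha>)" if "\<alpha> \<noteq> 0" for \<alpha>
    unfolding X_def by (rule smooth_on_scaleR_const[OF U smZ[OF that]])
  have Zg: "exp_coeff Z (\<lambda>x. x) \<alpha> x = g \<alpha> x" if "x \<in> U" for \<alpha> x
    using Z g0[OF that] by (cases "\<alpha> = 0") (simp_all add: exp_coeff_0)
  have expansion: "exp_expansion \<gamma> U X N K" if N: "1 \<le> N" and K: "compact K" "K \<subseteq> U" for N K
  proof -
    obtain C \<delta> where "0 < \<delta>"
      and d: "\<And>x t. x \<in> K \<Longrightarrow> norm t < \<delta> \<Longrightarrow> exp_vf_defined U (truncated_field X N t) x"
      and C: "\<And>x t. x \<in> K \<Longrightarrow> norm t < \<delta> \<Longrightarrow> norm (exp_vf U (truncated_field X N t) x -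
        (\<Sum>\<alpha> | mi_order \<alpha> < N. mi_power t \<alpha> *\<^sub>R exp_coeff Z (\<lambda>x. x) \<alpha> x)) \<le> C * norm t ^ N"
      using exp_vf_expansion[where Y = X, OF U smX K N] unfolding XZ by blast
    have KW: "(x, 0) \<in> W" if "x \<in> K" for x
      using that K(2) by (auto simp: U_def e_def)
    obtain C' \<delta>' where "0 < \<delta>'"
      and C': "\<And>x t. x \<in> K \<Longrightarrow> norm t < \<delta>' \<Longrightarrow>
        norm (\<gamma> (x, t) - (\<Sum>\<alpha> | mi_order \<alpha> < N. mi_power t \<alpha> *\<^sub>R g \<alpha> x)) \<le> C' * norm t ^ N"
      using taylor_expansion_parameter[OF assms(1,3) K(1) KW N] unfolding g_def e_def by blast
    have "norm (\<gamma> (x, t) - exp_vf U (truncated_field X N t) x) \<le> (C' + C) * norm t ^ N"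
      if "x \<in> K" "norm t < min \<delta> \<delta>'" for x t
    proof -
      have "x \<in> U" using that K by blast
      \<comment> \<open>On \<open>U\<close> both expansions have the same coefficients, so the sums
        cancel and the two error bounds add up.\<close>
      then show ?thesis
        using norm_triangle_le_diff[OF add_mono[OF C'[of x t] C[of x t]]] that
        by (simp add: Zg distrib_right)
    qed
    then show ?thesis unfolding exp_expansion_def
      using d \<open>0 < \<delta>\<close> \<open>0 < \<delta>'\<close> by (intro exI[of _ "C' + C"] exI[of _ "min \<delta> \<delta>'"]) auto
  qed
  have unique: "Y \<alpha> x = X \<alpha> x"
    if V: "open V" "\<And>x. x \<in> V \<Longrightarrow> (x, 0) \<in> W" and smY: "\<And>\<alpha>. \<alpha> \<noteq> 0 \<Longrightarrow> smooth_on V (Y \<alpha>)"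
      and Y: "\<And>N x. N \<ge> 1 \<Longrightarrow> x \<in> V \<Longrightarrow> exp_expansion \<gamma> V Y N {x}"
      and \<alpha>: "\<alpha> \<noteq> 0" and x: "x \<in> U \<inter> V" for V Y \<alpha> x
  proof -
    define Z' where "Z' \<alpha> x = (1 / mi_fact \<alpha>) *\<^sub>R Y \<alpha> x" for \<alpha> x
    \<comment> \<open>Here \<open>y\<close> is fixed and only \<open>t\<close> varies, so the
      constants may depend on \<open>y\<close>.\<close>
    have "exp_coeff Z' (\<lambda>x. x) \<beta> y - g \<beta> y = 0" if y: "y \<in> V" for \<beta> y
    proof (rule asymptotic_expansion_unique)
      fix N :: nat assume N: "N \<ge> 1"
      have K: "compact {y}" "{y} \<subseteq> V" "\<And>x. x \<in> {y} \<Longrightarrow> (x, 0) \<in> W" using y V(2) by auto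
      obtain C \<delta> where "0 < \<delta>"
        and C: "\<And>t. norm t < \<delta> \<Longrightarrow> norm (exp_vf V (truncated_field Y N t) y -
          (\<Sum>\<alpha> | mi_order \<alpha> < N. mi_power t \<alpha> *\<^sub>R exp_coeff Z' (\<lambda>x. x) \<alpha> y)) \<le> C * norm t ^ N"
        using exp_vf_expansion[where Y = Y, OF V(1) smY K(1,2) N] unfolding Z'_def by blast
      obtain C' \<delta>' where "0 < \<delta>'"
        and C': "\<And>t. norm t < \<delta>' \<Longrightarrow>
          norm (\<gamma> (y, t) - (\<Sum>\<alpha> | mi_order \<alpha> < N. mi_power t \<alpha> *\<^sub>R g \<alpha> y)) \<le> C' * norm t ^ N"
        using taylor_expansion_parameter[OF assms(1,3) K(1,3) N] unfolding g_def e_def by blast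
      obtain D \<delta>'' where "0 < \<delta>''"
        and D: "\<And>t. norm t < \<delta>'' \<Longrightarrow> norm (\<gamma> (y, t) - exp_vf V (truncated_field Y N t) y) \<le> D * norm t ^ N"
        using Y[OF N y] unfolding exp_expansion_def by auto
      have "norm (\<Sum>\<alpha> | mi_order \<alpha> < N. mi_power t \<alpha> *\<^sub>R (exp_coeff Z' (\<lambda>x. x) \<alpha> y - g \<alpha> y))
          \<le> (C' + D + C) * norm t ^ N" if "norm t < min \<delta> (min \<delta>' \<delta>'')" for t
      proof -
        let ?S = "\<lambda>h. \<Sum>\<alpha> | mi_order \<alpha> < N. mi_power t \<alpha> *\<^sub>R h \<alpha> y"
        let ?v = "exp_vf V (truncated_field Y N t) y"
        have "(\<Sum>\<alpha> | mi_order \<alpha> < N. mi_power t \<alpha> *\<^sub>R (exp_coeff Z' (\<lambda>x. x) \<alpha> y - g \<alpha> y))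
            = (\<gamma> (y, t) - ?S g) - (\<gamma> (y, t) - ?v) - (?v - ?S (exp_coeff Z' (\<lambda>x. x)))"
          by (simp add: scaleR_diff_right sum_subtractf)
        also have "norm \<dots> \<le> C' * norm t ^ N + D * norm t ^ N + C * norm t ^ N"
          using that by (intro norm_triangle_le_diff[OF add_mono] C C' D) auto
        finally show ?thesis by (simp add: distrib_right)
      qed
      then show "\<exists>C \<delta>. 0 < \<delta> \<and> (\<forall>t. norm t < \<delta> \<longrightarrow>
          norm (\<Sum>\<alpha> | mi_order \<alpha> < N. mi_power t \<alpha> *\<^sub>R (exp_coeff Z' (\<lambda>x. x) \<alpha> y - g \<alpha> y)) \<le> C * norm t ^ N)"
        using \<open>0 < \<delta>\<close> \<open>0 < \<delta>'\<close> \<open>0 < \<delta>''\<close>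
        by (intro exI[of _ "C' + D + C"] exI[of _ "min \<delta> (min \<delta>' \<delta>'')"]) auto
    qed
    \<comment> \<open>The equality is collected over an open set because recovering the fields from
      the coefficients involves derivatives.\<close>
    then have "exp_coeff Z' (\<lambda>x. x) \<beta> y = exp_coeff Z (\<lambda>x. x) \<beta> y" if "y \<in> U \<inter> V" for \<beta> y
      using that Zg by simp
    then have "Z' \<alpha> x = Z \<alpha> x"
      using exp_coeff_id_inj[OF open_Int[OF U V(1)] _ \<alpha> x] by blast
    then show ?thesis
      using mi_fact_nonzero[of \<alpha>] by (simp add: X_def Z'_def flip: \<open>Z' \<alpha> x = Z \<alpha> x\<close>)
  qed
  show ?thesis
  proof (intro exI[of _ U] exI[of _ X] conjI allI impI ballI)
    show "open U" by (rule U)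
    show "x0 \<in> U" using assms(2) by (simp add: U_def e_def)
    show "(x, 0) \<in> W" if "x \<in> U" for x using that by (simp add: U_def e_def)
    show "smooth_on U (X \<alpha>)" if "\<alpha> \<noteq> 0" for \<alpha> by (rule smX[OF that])
    show "exp_expansion \<gamma> U X N K" if "1 \<le> N" "compact K \<and> K \<subseteq> U" for N K
      using expansion that by blast
  qed (use unique in blast)
qed

end
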